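(* Let $B$ be a paracompact Hausdorff space and $\mathcal{U}=\{U_r\}$ an open cover of $B$. For $\tau\in Z^1(\mathcal{N}(\mathcal{U});\mathbb{Z}/2)$ let $\phi^\tau=\{\phi^\tau_{rt}\}\in\check{Z}^1(\mathcal{U};\mathscr{C}_{\mathbb{R}}^\times)$ be the Čech cocycle of constant functions $\phi^\tau_{rt}:U_r\cap U_t\to\mathbb{R}^\times$, $\phi^\tau_{rt}\equiv(-1)^{\tau_{rt}}$. Then the homomorphism $$\Phi_{\mathcal{U}}:H^1(\mathcal{N}(\mathcal{U});\mathbb{Z}/2)\longrightarrow\check{H}^1(\mathcal{U};\mathscr{C}_{\mathbb{R}}^\times),\qquad[\tau]\mapsto[\phi^\tau],$$ is natural with respect to refinements. Moreover, if each $U_r$ is connected, then $\Phi_{\mathcal{U}}$ is injective.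
   Context: The nerve $\mathcal{N}(\mathcal{U})$ is the abstract simplicial complex with one vertex $r$ for each $U_r\in\mathcal{U}$ and a simplex $\{r_0,\ldots,r_k\}$ for each collection with $U_{r_0}\cap\cdots\cap U_{r_k}\ne\emptyset$. For a simplicial complex $K$ and an abelian group $G$, the group of cochains $C^k(K;G)$ consists of the functions from the set of $k$-simplices of $K$ to $G$ which are zero on all but finitely many $k$-simplices, with the usual simplicial coboundary; $Z^k$, $H^k$ are cocycles and cohomology. Write $\tau_{rt}=\tau(\{r,t\})\in\{0,1\}=\mathbb{Z}/2$, with $\tau_{rr}=0$. $\mathscr{C}_{\mathbb{R}}^\times$ is the sheaf on $B$ of continuous $\mathbb{R}^\times$-valued functions (group operation: multiplication). For a presheaf $\mathcal{F}$ of abelian groups, $\check{C}^n(\mathcal{U};\mathcal{F})=\prod_{(j_0,\ldots,j_n)}\mathcal{F}(U_{j_0}\cap\cdots\cap U_{j_n})$, with coboundary $(\delta f)_{k_0,\ldots,k_{n+1}}=\sum_r(-1)^rf_{k_0,\ldots,\widehat{k_r},\ldots,k_{n+1}}$ restricted to $U_{k_0}\cap\cdots\cap U_{k_{n+1}}$ (written multiplicatively for $\mathscr{C}_{\mathbb{R}}^\times$); $\check{Z}^n$, $\check{H}^n$ are the resulting cocycles and cohomology. A cover $\mathcal{V}$ of $B$ is a refinement of $\mathcal{U}$ if every $V\in\mathcal{V}$ is contained in some $U\in\mathcal{U}$. Naturality with respect to refinements means that the homomorphisms induced by a refinement, $H^1(\mathcal{N}(\mathcal{U});\mathbb{Z}/2)\to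 H^1(\mathcal{N}(\mathcal{V});\mathbb{Z}/2)$ and $\check{H}^1(\mathcal{U};\mathscr{C}_{\mathbb{R}}^\times)\to\check{H}^1(\mathcal{V};\mathscr{C}_{\mathbb{R}}^\times)$, commute with $\Phi_{\mathcal{U}}$ and $\Phi_{\mathcal{V}}$.
   Formalization: Cochains of the nerve are arbitrary functions on simplices, not finitely supported ones; with finite support injectivity fails (cover of the real line by the intervals (n-1,n+1)) and the coboundary may be undefined. For finite covers the two agree. *)

theory Defs
  imports "HOL-Analysis.Analysis" "HOL-Algebra.Product_Groups" "HOL-Algebra.FiniteProduct"
begin

section \<open>Spaces and covers\<close>

definition paracompact_space :: "'a topology \<Rightarrow> bool" where
  "paracompact_space X \<longleftrightarrow>
     (\<forall>\<U>. (\<forall>U\<in>\<U>. openin X U) \<and> \<Union>\<U> = topspace X \<longrightarrow>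
       (\<exists>\<V>. (\<forall>V\<in>\<V>. openin X V) \<and> \<Union>\<V> = topspace X \<and>
            (\<forall>V\<in>\<V>. \<exists>U\<in>\<U>. V \<subseteq> U) \<and> locally_finite_in X \<V>))"

definition open_cover :: "'a topology \<Rightarrow> 'i set \<Rightarrow> ('i \<Rightarrow> 'a set) \<Rightarrow> bool" where
  "open_cover X I U \<longleftrightarrow> (\<forall>r\<in>I. openin X (U r)) \<and> (\<Union>r\<in>I. U r) = topspace X"

definition refines :: "'j set \<Rightarrow> ('j \<Rightarrow> 'a set) \<Rightarrow> 'i set \<Rightarrow> ('i \<Rightarrow> 'a set) \<Rightarrow> bool" where
  "refines J V I U \<longleftrightarrow> (\<forall>s\<in>J. \<exists>r\<in>I. V s \<subseteq> U r)"

definition refining_map ::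
  "'j set \<Rightarrow> ('j \<Rightarrow> 'a set) \<Rightarrow> 'i set \<Rightarrow> ('i \<Rightarrow> 'a set) \<Rightarrow> ('j \<Rightarrow> 'i) \<Rightarrow> bool" where
  "refining_map J V I U p \<longleftrightarrow> (\<forall>s\<in>J. p s \<in> I \<and> V s \<subseteq> U (p s))"

lemma refines_iff_refining_map: "refines J V I U \<longleftrightarrow> (\<exists>p. refining_map J V I U p)"
  unfolding refines_def refining_map_def by (metis (no_types))


section \<open>Cohomology of a sequence of groups and coboundary maps\<close>

definition cocycles :: "(nat \<Rightarrow> 'c monoid) \<Rightarrow> (nat \<Rightarrow> 'c \<Rightarrow> 'c) \<Rightarrow> nat \<Rightarrow> 'c set" where
  "cocycles C d n = kernel (C n) (C (Suc n)) (d n)"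

definition coboundaries :: "(nat \<Rightarrow> 'c monoid) \<Rightarrow> (nat \<Rightarrow> 'c \<Rightarrow> 'c) \<Rightarrow> nat \<Rightarrow> 'c set" where
  "coboundaries C d n =
     (case n of 0 \<Rightarrow> {\<one>\<^bsub>C 0\<^esub>} | Suc m \<Rightarrow> d m ` carrier (C m))"

definition cohomology :: "(nat \<Rightarrow> 'c monoid) \<Rightarrow> (nat \<Rightarrow> 'c \<Rightarrow> 'c) \<Rightarrow> nat \<Rightarrow> 'c set monoid" where
  "cohomology C d n = (C n)\<lparr>carrier := cocycles C d n\<rparr> Mod coboundaries C d n"

definition cohomology_class ::
  "(nat \<Rightarrow> 'c monoid) \<Rightarrow> (nat \<Rightarrow> 'c \<Rightarrow> 'c) \<Rightarrow> nat \<Rightarrow> 'c \<Rightarrow> 'c set" where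
  "cohomology_class C d n c = coboundaries C d n #>\<^bsub>C n\<^esub> c"

text \<open>
  The map on classes sending the class of \<open>c\<close> to the class of \<open>h c\<close>: a class is a coset, and
  when \<open>h\<close> respects classes all members of the union are the same coset of the target.
\<close>

definition induced_map ::
  "(nat \<Rightarrow> 'd monoid) \<Rightarrow> (nat \<Rightarrow> 'd \<Rightarrow> 'd) \<Rightarrow> nat \<Rightarrow> ('c \<Rightarrow> 'd) \<Rightarrow> 'c set \<Rightarrow> 'd set" where
  "induced_map D e n h X = (\<Union>c\<in>X. cohomology_class D e n (h c))"


section \<open>Nerves and simplicial cochains modulo 2\<close>

definition nerve :: "'i set \<Rightarrow> ('i \<Rightarrow> 'a set) \<Rightarrow> 'i set set" where
  "nerve I U = {\<sigma>. finite \<sigma> \<and> \<sigma> \<noteq> {} \<and> \<sigma> \<subseteq> I \<and> (\<Inter>r\<in>\<sigma>. U r) \<noteq> {}}"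

definition simplices :: "'i set set \<Rightarrow> nat \<Rightarrow> 'i set set" where
  "simplices K k = {\<sigma>\<in>K. card \<sigma> = Suc k}"

text \<open>
  All functions on the simplices are admitted. If only finitely supported ones are, then the
  coboundary need not preserve cochains, a refinement need not induce a map of cochains, and
  injectivity of the comparison with Cech cohomology fails: for the cover of the real line by the
  intervals \<open>(n - 1, n + 1)\<close>, the cochain supported on the single edge \<open>{0, 1}\<close> is the coboundary
  only of cochains of infinite support. When the cover is finite the two notions agree, see the
  lemma \<open>simplicial_cochains_nerve_finite\<close>.
\<close>

definition simplicial_cochains :: "'i set set \<Rightarrow> nat \<Rightarrow> ('i set \<Rightarrow> int) monoid" where
  "simplicial_cochains K k = product_group (simplices K k) (\<lambda>_. integer_mod_group 2)"

lemma simplicial_cochains_nerve_finite: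
  assumes "finite I"
  shows "simplicial_cochains (nerve I U) k
       = sum_group (simplices (nerve I U) k) (\<lambda>_. integer_mod_group 2)"
proof -
  let ?S = "simplices (nerve I U) k"
  let ?G = "product_group ?S (\<lambda>_. integer_mod_group 2)"
  have "?S \<subseteq> Pow I" by (auto simp: simplices_def nerve_def)
  with assms have fin: "finite ?S" by (meson finite_Pow_iff finite_subset)
  interpret group ?G by (rule product_group) simp
  have eq: "{x \<in> \<Pi>\<^sub>E i\<in>?S. carrier (integer_mod_group 2).
         finite {i \<in> ?S. x i \<noteq> \<one>\<^bsub>integer_mod_group 2\<^esub>}} = carrier ?G"
    using fin by simp
  show ?thesis
    unfolding simplicial_cochains_def sum_group_def eq
    by (rule subgroup_generated_group_carrier [symmetric])
qed

text \<open>Modulo 2 the orientation signs in the simplicial coboundary disappear.\<close>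

definition simplicial_coboundary ::
  "'i set set \<Rightarrow> nat \<Rightarrow> ('i set \<Rightarrow> int) \<Rightarrow> ('i set \<Rightarrow> int)" where
  "simplicial_coboundary K k c = (\<lambda>\<sigma>\<in>simplices K (Suc k). (\<Sum>v\<in>\<sigma>. c (\<sigma> - {v})) mod 2)"

text \<open>The pullback along a vertex map vanishes on the simplices which the map collapses.\<close>

definition simplicial_pullback ::
  "'j set set \<Rightarrow> ('j \<Rightarrow> 'i) \<Rightarrow> nat \<Rightarrow> ('i set \<Rightarrow> int) \<Rightarrow> ('j set \<Rightarrow> int)" where
  "simplicial_pullback L p k c =
     (\<lambda>\<sigma>\<in>simplices L k. if card (p ` \<sigma>) = card \<sigma> then c (p ` \<sigma>) else 0)"


section \<open>Cech cochains\<close>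

record ('a, 'b) presheaf =
  sections :: "'a set \<Rightarrow> 'b monoid"
  restr :: "'a set \<Rightarrow> 'a set \<Rightarrow> 'b \<Rightarrow> 'b"  \<comment> \<open>\<open>restr F V W\<close> goes from sections over \<open>V\<close> to sections over \<open>W\<close>\<close>

definition tuples :: "'i set \<Rightarrow> nat \<Rightarrow> 'i list set" where
  "tuples I n = {js. length js = Suc n \<and> set js \<subseteq> I}"

definition overlap :: "('i \<Rightarrow> 'a set) \<Rightarrow> 'i list \<Rightarrow> 'a set" where
  "overlap U js = (\<Inter>r\<in>set js. U r)"

definition omit :: "nat \<Rightarrow> 'i list \<Rightarrow> 'i list" where
  "omit r js = take r js @ drop (Suc r) js"

definition cech_cochains ::
  "('a, 'b) presheaf \<Rightarrow> 'i set \<Rightarrow> ('i \<Rightarrow> 'a set) \<Rightarrow> nat \<Rightarrow> ('i list \<Rightarrow> 'b) monoid" where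
  "cech_cochains F I U n = product_group (tuples I n) (\<lambda>js. sections F (overlap U js))"

definition cech_coboundary ::
  "('a, 'b) presheaf \<Rightarrow> 'i set \<Rightarrow> ('i \<Rightarrow> 'a set) \<Rightarrow> nat \<Rightarrow> ('i list \<Rightarrow> 'b) \<Rightarrow> ('i list \<Rightarrow> 'b)" where
  "cech_coboundary F I U n f =
     (\<lambda>ks\<in>tuples I (Suc n).
        finprod (sections F (overlap U ks))
          (\<lambda>r. restr F (overlap U (omit r ks)) (overlap U ks) (f (omit r ks))
                 [^]\<^bsub>sections F (overlap U ks)\<^esub> ((-1) ^ r :: int))
          {..Suc n})"

definition cech_pullback ::
  "('a, 'b) presheaf \<Rightarrow> ('i \<Rightarrow> 'a set) \<Rightarrow> 'j set \<Rightarrow> ('j \<Rightarrow> 'a set) \<Rightarrow> ('j \<Rightarrow> 'i) \<Rightarrow> nat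
     \<Rightarrow> ('i list \<Rightarrow> 'b) \<Rightarrow> ('j list \<Rightarrow> 'b)" where
  "cech_pullback F U J V p n f =
     (\<lambda>js\<in>tuples J n. restr F (overlap U (map p js)) (overlap V js) (f (map p js)))"

text \<open>Continuous functions to the nonzero reals under multiplication.\<close>

definition units_sheaf :: "'a topology \<Rightarrow> ('a, 'a \<Rightarrow> real) presheaf" where
  "units_sheaf X =
     \<lparr>sections = (\<lambda>V.
        \<lparr>carrier = {f \<in> extensional V.
                      continuous_map (subtopology X V) (top_of_set (- {0})) f},
         monoid.mult = (\<lambda>f g. \<lambda>x\<in>V. f x * g x),
         one = (\<lambda>x\<in>V. 1)\<rparr>),
      restr = (\<lambda>V W f. restrict f W)\<rparr>"


section \<open>The groups and maps of the comparison\<close>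

abbreviation nerve_C :: "'i set \<Rightarrow> ('i \<Rightarrow> 'a set) \<Rightarrow> nat \<Rightarrow> ('i set \<Rightarrow> int) monoid" where
  "nerve_C I U \<equiv> simplicial_cochains (nerve I U)"

abbreviation nerve_d ::
  "'i set \<Rightarrow> ('i \<Rightarrow> 'a set) \<Rightarrow> nat \<Rightarrow> ('i set \<Rightarrow> int) \<Rightarrow> ('i set \<Rightarrow> int)" where
  "nerve_d I U \<equiv> simplicial_coboundary (nerve I U)"

abbreviation units_C ::
  "'a topology \<Rightarrow> 'i set \<Rightarrow> ('i \<Rightarrow> 'a set) \<Rightarrow> nat \<Rightarrow> ('i list \<Rightarrow> 'a \<Rightarrow> real) monoid" where
  "units_C X I U \<equiv> cech_cochains (units_sheaf X) I U"

abbreviation units_d ::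
  "'a topology \<Rightarrow> 'i set \<Rightarrow> ('i \<Rightarrow> 'a set) \<Rightarrow> nat
     \<Rightarrow> ('i list \<Rightarrow> 'a \<Rightarrow> real) \<Rightarrow> ('i list \<Rightarrow> 'a \<Rightarrow> real)" where
  "units_d X I U \<equiv> cech_coboundary (units_sheaf X) I U"

abbreviation nerve_H1 :: "'i set \<Rightarrow> ('i \<Rightarrow> 'a set) \<Rightarrow> ('i set \<Rightarrow> int) set monoid" where
  "nerve_H1 I U \<equiv> cohomology (nerve_C I U) (nerve_d I U) 1"

abbreviation units_H1 ::
  "'a topology \<Rightarrow> 'i set \<Rightarrow> ('i \<Rightarrow> 'a set) \<Rightarrow> ('i list \<Rightarrow> 'a \<Rightarrow> real) set monoid" where
  "units_H1 X I U \<equiv> cohomology (units_C X I U) (units_d X I U) 1"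

definition edge_value :: "('i set \<Rightarrow> int) \<Rightarrow> 'i \<Rightarrow> 'i \<Rightarrow> int" where
  "edge_value \<tau> r t = (if r = t then 0 else \<tau> {r, t})"

definition sign_cochain ::
  "'i set \<Rightarrow> ('i \<Rightarrow> 'a set) \<Rightarrow> ('i set \<Rightarrow> int) \<Rightarrow> ('i list \<Rightarrow> 'a \<Rightarrow> real)" where
  "sign_cochain I U \<tau> =
     (\<lambda>js\<in>tuples I 1. \<lambda>x\<in>overlap U js. (-1) powi edge_value \<tau> (js ! 0) (js ! 1))"

definition Phi ::
  "'a topology \<Rightarrow> 'i set \<Rightarrow> ('i \<Rightarrow> 'a set) \<Rightarrow> ('i set \<Rightarrow> int) set \<Rightarrow> ('i list \<Rightarrow> 'a \<Rightarrow> real) set" where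
  "Phi X I U = induced_map (units_C X I U) (units_d X I U) 1 (sign_cochain I U)"

definition nerve_refine ::
  "'j set \<Rightarrow> ('j \<Rightarrow> 'a set) \<Rightarrow> ('j \<Rightarrow> 'i) \<Rightarrow> ('i set \<Rightarrow> int) set \<Rightarrow> ('j set \<Rightarrow> int) set" where
  "nerve_refine J V p =
     induced_map (nerve_C J V) (nerve_d J V) 1 (simplicial_pullback (nerve J V) p 1)"

definition units_refine ::
  "'a topology \<Rightarrow> ('i \<Rightarrow> 'a set) \<Rightarrow> 'j set \<Rightarrow> ('j \<Rightarrow> 'a set) \<Rightarrow> ('j \<Rightarrow> 'i)
     \<Rightarrow> ('i list \<Rightarrow> 'a \<Rightarrow> real) set \<Rightarrow> ('j list \<Rightarrow> 'a \<Rightarrow> real) set" where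
  "units_refine X U J V p =
     induced_map (units_C X J V) (units_d X J V) 1 (cech_pullback (units_sheaf X) U J V p 1)"

end

theory Submission
  imports Defs
begin

text \<open>
  A 1-cochain of the nerve is a cocycle, or a coboundary, exactly when its values \<open>edge_value \<tau> a b\<close>
  on ordered pairs of overlapping sets are so modulo 2; exponentiating \<open>-1\<close> turns these conditions
  into the corresponding multiplicative ones, and the comparison commutes with pullback already on
  cochains. If \<open>\<phi>\<^sup>\<tau>\<close> is the coboundary of a family of nonvanishing functions \<open>f\<^sub>r\<close> on connected sets, then
  each \<open>f\<^sub>r\<close> has constant sign, and the signs form a 0-cochain of the nerve with coboundary \<open>\<tau>\<close>.
\<close>

section \<open>Maps induced on cohomology\<close>

text \<open>The two sides index cochains differently: the nerve uses sets of distinct indices with a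
  common point, while Cech cochains use all ordered tuples, including those with repeated entries
  and with empty overlap. Repetitions are absorbed by \<open>edge_value\<close>, which vanishes on
  the diagonal, so that every degenerate cocycle condition holds automatically. Empty overlaps are
  harmless because the only section over the empty set is the empty function, so the unspecified
  values of a cochain off the nerve never show. Orientation plays no part because 1 and -1 are their
  own inverses. Injectivity depends on connectedness because on a disconnected set a nonvanishing
  function may change sign between components, and then no single bit per index records its
  sign.\<close>

locale cochain_segment =
  fixes C :: "nat \<Rightarrow> 'c monoid" and d :: "nat \<Rightarrow> 'c \<Rightarrow> 'c" and n :: nat
  assumes comm_group_cochains: "comm_group (C k)"
    and coboundary_hom: "d k \<in> hom (C k) (C (Suc k))"
    and coboundary_coboundary: "c \<in> carrier (C n) \<Longrightarrow> d (Suc n) (d n c) = \<one>\<^bsub>C (Suc (Suc n))\<^esub>"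
begin

abbreviation "Z \<equiv> cocycles C d (Suc n)"
abbreviation "B \<equiv> coboundaries C d (Suc n)"
abbreviation "ZG \<equiv> (C (Suc n))\<lparr>carrier := Z\<rparr>"

lemma group_cochains: "group (C k)"
  using comm_group_cochains by (rule comm_group.axioms)

lemma group_hom_coboundary: "group_hom (C k) (C (Suc k)) (d k)"
  by (simp add: group_hom_def group_hom_axioms_def group_cochains coboundary_hom)

lemma subgroup_cocycles: "subgroup Z (C (Suc n))"
  unfolding cocycles_def by (rule group_hom.subgroup_kernel[OF group_hom_coboundary])

lemma cocycles_closed: "c \<in> Z \<Longrightarrow> c \<in> carrier (C (Suc n))"
  by (simp add: cocycles_def kernel_def)

lemma subgroup_coboundaries: "subgroup B (C (Suc n))"
  unfolding coboundaries_def by (simp add: group_hom.img_is_subgroup[OF group_hom_coboundary])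

text \<open>This is the one place where two consecutive coboundary maps meet, which is why the
  locale asks for \<open>coboundary_coboundary\<close> in degree \<open>n\<close> alone.\<close>

lemma coboundaries_subset: "B \<subseteq> Z"
  using coboundary_hom[of n]
  by (auto simp: coboundaries_def cocycles_def kernel_def coboundary_coboundary hom_def)

lemma comm_group_cocycles: "comm_group ZG"
proof (rule group.group_comm_groupI)
  show "group ZG"
    by (rule group.subgroup_imp_group[OF group_cochains subgroup_cocycles])
qed (simp add: cocycles_closed comm_monoid.m_comm[OF comm_group.axioms(1)[OF comm_group_cochains]])

lemma normal_coboundaries: "B \<lhd> ZG"
proof -
  have "subgroup B ZG"
    by (rule group.subgroup_incl[OF group_cochains subgroup_coboundaries subgroup_cocycles
          coboundaries_subset])
  then show ?thesis
    using comm_group.normal_iff_subgroup[OF comm_group_cocycles] by blast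
qed

lemma group_cohomology: "group (cohomology C d (Suc n))"
  unfolding cohomology_def by (rule normal.factorgroup_is_group[OF normal_coboundaries])

text \<open>Classes are cosets in the full cochain group, but the quotient is formed inside the
  cocycles. Both groups multiply alike, so the two cosets agree.\<close>

lemma cohomology_class_coset: "cohomology_class C d (Suc n) c = B #>\<^bsub>ZG\<^esub> c"
  by (simp add: cohomology_class_def r_coset_def)

lemma carrier_cohomology: "carrier (cohomology C d (Suc n)) = cohomology_class C d (Suc n) ` Z"
  by (auto simp: cohomology_def FactGroup_def RCOSETS_def cohomology_class_coset)

lemma cohomology_class_mult:
  assumes "a \<in> Z" "b \<in> Z"
  shows "cohomology_class C d (Suc n) a \<otimes>\<^bsub>cohomology C d (Suc n)\<^esub> cohomology_class C d (Suc n) b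
       = cohomology_class C d (Suc n) (a \<otimes>\<^bsub>C (Suc n)\<^esub> b)"
  using normal.rcos_sum[OF normal_coboundaries, of a b] assms
  by (simp add: cohomology_def FactGroup_def cohomology_class_coset)

text \<open>Cosets of a subgroup that share an element coincide. This is what makes
  \<open>induced_map\<close> independent of the representative.\<close>

lemma cohomology_class_shift:
  assumes "b \<in> B" "c \<in> Z"
  shows "cohomology_class C d (Suc n) (b \<otimes>\<^bsub>C (Suc n)\<^esub> c) = cohomology_class C d (Suc n) c"
proof -
  interpret G: group ZG by (rule comm_group.axioms[OF comm_group_cocycles])
  have s: "subgroup B ZG" by (rule normal_imp_subgroup[OF normal_coboundaries])
  then have "b \<otimes>\<^bsub>ZG\<^esub> c \<in> B #>\<^bsub>ZG\<^esub> c" using assms by (auto simp: r_coset_def)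
  then show ?thesis
    using G.repr_independence[OF _ _ s, of "b \<otimes>\<^bsub>ZG\<^esub> c" c] assms(2)
    by (simp add: cohomology_class_coset)
qed

lemma cohomology_class_mem:
  assumes "c \<in> Z"
  shows "c \<in> cohomology_class C d (Suc n) c"
proof -
  have "\<one>\<^bsub>C (Suc n)\<^esub> \<otimes>\<^bsub>C (Suc n)\<^esub> c = c"
    using monoid.l_one[OF group.is_monoid[OF group_cochains]] cocycles_closed[OF assms] .
  then show ?thesis
    using subgroup.one_closed[OF subgroup_coboundaries]
    by (auto simp: cohomology_class_def r_coset_def intro!: bexI)
qed

lemma one_cohomology: "\<one>\<^bsub>cohomology C d (Suc n)\<^esub> = B"
  by (simp add: cohomology_def FactGroup_def)

lemma cohomology_class_eq_one_iff:
  assumes "c \<in> Z"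
  shows "cohomology_class C d (Suc n) c = \<one>\<^bsub>cohomology C d (Suc n)\<^esub> \<longleftrightarrow> c \<in> B"
proof
  assume "cohomology_class C d (Suc n) c = \<one>\<^bsub>cohomology C d (Suc n)\<^esub>"
  then show "c \<in> B" using cohomology_class_mem[OF assms] by (simp add: one_cohomology)
next
  assume "c \<in> B"
  then show "cohomology_class C d (Suc n) c = \<one>\<^bsub>cohomology C d (Suc n)\<^esub>"
    using group.coset_join2[OF group_cochains _ subgroup_coboundaries] assms
    by (simp add: one_cohomology cohomology_class_def cocycles_closed)
qed

end

text \<open>A single map in degree \<open>Suc n\<close> stands in place of a full chain map, because
  \<open>sign_cochain\<close> exists in degree 1 only and has no neighbouring maps to commute with.
  Additivity and preservation of cocycles and coboundaries suffice for a map on cohomology.\<close>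

locale cochain_map =
  source: cochain_segment C d n + target: cochain_segment D e n
  for C :: "nat \<Rightarrow> 'c monoid" and d and D :: "nat \<Rightarrow> 'd monoid" and e and n :: nat +
  fixes h :: "'c \<Rightarrow> 'd"
  assumes map_hom: "h \<in> hom (C (Suc n)) (D (Suc n))"
    and map_cocycles: "c \<in> cocycles C d (Suc n) \<Longrightarrow> h c \<in> cocycles D e (Suc n)"
    and map_coboundaries: "c \<in> coboundaries C d (Suc n) \<Longrightarrow> h c \<in> coboundaries D e (Suc n)"
begin

text \<open>Two members of a class differ by a coboundary, which \<open>h\<close> sends to a
  coboundary. Hence all cosets in the union are equal, and the union is not empty since a class
  contains its representative.\<close>

lemma induced_map_class:
  assumes c: "c \<in> cocycles C d (Suc n)"
  shows "induced_map D e (Suc n) h (cohomology_class C d (Suc n) c)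
       = cohomology_class D e (Suc n) (h c)"
proof -
  have "cohomology_class D e (Suc n) (h x) = cohomology_class D e (Suc n) (h c)"
    if x: "x \<in> cohomology_class C d (Suc n) c" for x
  proof -
    obtain b where b: "b \<in> coboundaries C d (Suc n)" "x = b \<otimes>\<^bsub>C (Suc n)\<^esub> c"
      using x unfolding cohomology_class_def r_coset_def by blast
    then have "h x = h b \<otimes>\<^bsub>D (Suc n)\<^esub> h c"
      using map_hom source.coboundaries_subset source.cocycles_closed c by (auto simp: hom_def)
    then show ?thesis
      using target.cohomology_class_shift map_coboundaries map_cocycles b c by simp
  qed
  then show ?thesis
    using source.cohomology_class_mem[OF c] unfolding induced_map_def by blast
qed

lemma group_hom_induced_map:
  "group_hom (cohomology C d (Suc n)) (cohomology D e (Suc n)) (induced_map D e (Suc n) h)"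
proof -
  have "induced_map D e (Suc n) h \<in> hom (cohomology C d (Suc n)) (cohomology D e (Suc n))"
  proof (rule homI)
    fix X assume "X \<in> carrier (cohomology C d (Suc n))"
    then show "induced_map D e (Suc n) h X \<in> carrier (cohomology D e (Suc n))"
      by (auto simp: source.carrier_cohomology target.carrier_cohomology induced_map_class
          map_cocycles)
  next
    fix X Y assume "X \<in> carrier (cohomology C d (Suc n))" "Y \<in> carrier (cohomology C d (Suc n))"
    then obtain a b where ab: "a \<in> source.Z" "b \<in> source.Z"
      and X: "X = cohomology_class C d (Suc n) a" and Y: "Y = cohomology_class C d (Suc n) b"
      by (auto simp: source.carrier_cohomology)
    have "a \<otimes>\<^bsub>C (Suc n)\<^esub> b \<in> source.Z"
      using subgroup.m_closed[OF source.subgroup_cocycles] ab .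
    moreover have "h (a \<otimes>\<^bsub>C (Suc n)\<^esub> b) = h a \<otimes>\<^bsub>D (Suc n)\<^esub> h b"
      using map_hom ab by (simp add: hom_mult source.cocycles_closed)
    ultimately show "induced_map D e (Suc n) h (X \<otimes>\<^bsub>cohomology C d (Suc n)\<^esub> Y)
        = induced_map D e (Suc n) h X \<otimes>\<^bsub>cohomology D e (Suc n)\<^esub> induced_map D e (Suc n) h Y"
      unfolding X Y
      by (simp add: source.cohomology_class_mult target.cohomology_class_mult induced_map_class
          map_cocycles ab)
  qed
  then show ?thesis
    by (simp add: group_hom_def group_hom_axioms_def source.group_cohomology
        target.group_cohomology)
qed

text \<open>A homomorphism with trivial kernel is injective, and a class in the kernel is
  represented by a cocycle whose image is a coboundary. The assumption is thus injectivity phrased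
  for representatives.\<close>

lemma inj_on_induced_map:
  assumes "\<And>c. c \<in> cocycles C d (Suc n) \<Longrightarrow> h c \<in> coboundaries D e (Suc n)
              \<Longrightarrow> c \<in> coboundaries C d (Suc n)"
  shows "inj_on (induced_map D e (Suc n) h) (carrier (cohomology C d (Suc n)))"
proof -
  interpret group_hom "cohomology C d (Suc n)" "cohomology D e (Suc n)"
    "induced_map D e (Suc n) h"
    by (rule group_hom_induced_map)
  show ?thesis
    unfolding inj_on_one_iff
  proof (intro allI impI)
    fix X assume X: "X \<in> carrier (cohomology C d (Suc n))"
      and one: "induced_map D e (Suc n) h X = \<one>\<^bsub>cohomology D e (Suc n)\<^esub>"
    obtain c where c: "c \<in> source.Z" "X = cohomology_class C d (Suc n) c"
      using X by (auto simp: source.carrier_cohomology)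
    then have "h c \<in> target.B"
      using one target.cohomology_class_eq_one_iff map_cocycles by (simp add: induced_map_class)
    then show "X = \<one>\<^bsub>cohomology C d (Suc n)\<^esub>"
      using assms c source.cohomology_class_eq_one_iff by simp
  qed
qed

end


section \<open>Cech cochains of nonvanishing functions\<close>

lemma comm_group_product_group:
  assumes "\<And>i. i \<in> I \<Longrightarrow> comm_group (G i)"
  shows "comm_group (product_group I G)"
proof (rule group.group_comm_groupI)
  show "group (product_group I G)"
    using assms by (simp add: comm_group.axioms)
qed (use assms in \<open>auto simp: PiE_iff intro!: restrict_ext
       comm_monoid.m_comm[OF comm_group.axioms(1)]\<close>)

lemma restrict_eq_restrict_iff: "restrict f A = restrict g A \<longleftrightarrow> (\<forall>x\<in>A. f x = g x)"
  by (auto simp: fun_eq_iff restrict_def)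

section \<open>Pointwise arithmetic of nonvanishing continuous functions\<close>

lemma mult_units_sheaf [simp]:
  "f \<otimes>\<^bsub>sections (units_sheaf X) V\<^esub> g = (\<lambda>x\<in>V. f x * g x)"
  and one_units_sheaf [simp]: "\<one>\<^bsub>sections (units_sheaf X) V\<^esub> = (\<lambda>x\<in>V. 1)"
  and restr_units_sheaf [simp]: "restr (units_sheaf X) V W f = restrict f W"
  by (simp_all add: units_sheaf_def)

text \<open>Continuity into the punctured line splits into real continuity and nonvanishing. The
  points of the subtopology are those of \<open>V\<close> lying in the space, so the assumption lets
  nonvanishing be stated on all of \<open>V\<close>.\<close>

lemma carrier_units_sheaf_iff:
  assumes "V \<subseteq> topspace X"
  shows "f \<in> carrier (sections (units_sheaf X) V) \<longleftrightarrow>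
     f \<in> extensional V \<and> continuous_map (subtopology X V) euclideanreal f \<and> (\<forall>x\<in>V. f x \<noteq> 0)"
  using assms by (auto simp: units_sheaf_def continuous_map_in_subtopology image_subset_iff)

lemma units_sheaf_restrict_closed:
  assumes "V \<subseteq> topspace X" "W \<subseteq> V" "f \<in> carrier (sections (units_sheaf X) V)"
  shows "restrict f W \<in> carrier (sections (units_sheaf X) W)"
proof -
  have "W \<subseteq> topspace X" using assms by blast
  moreover have "continuous_map (subtopology X W) euclideanreal (restrict f W)"
  proof (rule continuous_map_eq)
    show "continuous_map (subtopology X W) euclideanreal f"
      using assms continuous_map_from_subtopology_mono by (auto simp: carrier_units_sheaf_iff)
  qed auto
  ultimately show ?thesis
    using assms by (auto simp: carrier_units_sheaf_iff)
qed

lemma units_sheaf_inverse_closed: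
  assumes "V \<subseteq> topspace X" "f \<in> carrier (sections (units_sheaf X) V)"
  shows "(\<lambda>x\<in>V. inverse (f x)) \<in> carrier (sections (units_sheaf X) V)"
proof -
  have f: "continuous_map (subtopology X V) euclideanreal f" "\<And>x. x \<in> V \<Longrightarrow> f x \<noteq> 0"
    using assms by (auto simp: carrier_units_sheaf_iff)
  have "continuous_map (subtopology X V) euclideanreal (\<lambda>x\<in>V. inverse (f x))"
  proof (rule continuous_map_eq)
    show "continuous_map (subtopology X V) euclideanreal (\<lambda>x. inverse (f x))"
      using f by (intro continuous_map_real_inverse) auto
  qed auto
  then show ?thesis
    using assms f by (auto simp: carrier_units_sheaf_iff)
qed

lemma units_sheaf_mult_closed:
  assumes "V \<subseteq> topspace X" "f \<in> carrier (sections (units_sheaf X) V)"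
    "g \<in> carrier (sections (units_sheaf X) V)"
  shows "(\<lambda>x\<in>V. f x * g x) \<in> carrier (sections (units_sheaf X) V)"
proof -
  have "continuous_map (subtopology X V) euclideanreal (\<lambda>x\<in>V. f x * g x)"
  proof (rule continuous_map_eq)
    show "continuous_map (subtopology X V) euclideanreal (\<lambda>x. f x * g x)"
      using assms by (intro continuous_map_real_mult) (auto simp: carrier_units_sheaf_iff)
  qed auto
  then show ?thesis
    using assms by (auto simp: carrier_units_sheaf_iff)
qed

lemma units_sheaf_const_closed:
  assumes "V \<subseteq> topspace X" "a \<noteq> 0"
  shows "(\<lambda>x\<in>V. a) \<in> carrier (sections (units_sheaf X) V)"
proof -
  have "continuous_map (subtopology X V) euclideanreal (\<lambda>x\<in>V. a)"
    by (rule continuous_map_eq[where f = "\<lambda>_. a"]) auto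
  then show ?thesis
    using assms by (auto simp: carrier_units_sheaf_iff)
qed

lemma comm_group_units_sheaf:
  assumes V: "V \<subseteq> topspace X"
  shows "comm_group (sections (units_sheaf X) V)"
proof (rule comm_groupI)
  show "\<exists>g\<in>carrier (sections (units_sheaf X) V).
          g \<otimes>\<^bsub>sections (units_sheaf X) V\<^esub> f = \<one>\<^bsub>sections (units_sheaf X) V\<^esub>"
    if "f \<in> carrier (sections (units_sheaf X) V)" for f
    using that V
    by (intro bexI[OF _ units_sheaf_inverse_closed[OF V that]])
      (auto simp: carrier_units_sheaf_iff intro!: restrict_ext)
qed (auto simp: units_sheaf_mult_closed units_sheaf_const_closed V carrier_units_sheaf_iff
    extensional_def fun_eq_iff mult_ac intro: continuous_map_real_mult)

text \<open>\<open>cech_coboundary\<close> is phrased with the abstract product of the group of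
  sections; here that product becomes one of real numbers at each point.\<close>

lemma finprod_units_sheaf:
  assumes V: "V \<subseteq> topspace X" and "finite A"
    and "\<And>i. i \<in> A \<Longrightarrow> g i \<in> carrier (sections (units_sheaf X) V)"
  shows "finprod (sections (units_sheaf X) V) g A = (\<lambda>x\<in>V. \<Prod>i\<in>A. g i x)"
  using assms(2,3)
proof (induction A)
  case empty
  show ?case
    by (simp add: comm_monoid.finprod_empty[OF comm_group.axioms(1)[OF comm_group_units_sheaf[OF V]]])
next
  case (insert a A)
  then show ?case
    by (subst comm_monoid.finprod_insert[OF comm_group.axioms(1)[OF comm_group_units_sheaf[OF V]]])
      (auto intro!: restrict_ext)
qed

text \<open>The alternating sign of the coboundary appears as an exponent, always 1 or -1, so the
  group power is the section itself or its pointwise reciprocal.\<close>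

lemma int_pow_sign_units_sheaf:
  assumes V: "V \<subseteq> topspace X" and f: "f \<in> carrier (sections (units_sheaf X) V)"
  shows "f [^]\<^bsub>sections (units_sheaf X) V\<^esub> ((-1) ^ r :: int) = (\<lambda>x\<in>V. f x powi ((-1) ^ r))"
proof -
  interpret G: comm_group "sections (units_sheaf X) V"
    by (rule comm_group_units_sheaf[OF V])
  have ext: "f \<in> extensional V" and nz: "\<And>x. x \<in> V \<Longrightarrow> f x \<noteq> 0"
    using f V by (auto simp: carrier_units_sheaf_iff)
  show ?thesis
  proof (cases "even r")
    case True
    then show ?thesis using f ext by (auto simp: extensional_def)
  next
    case False
    have "inv\<^bsub>sections (units_sheaf X) V\<^esub> f = (\<lambda>x\<in>V. inverse (f x))"
      by (rule G.inv_equality) (use f nz in \<open>auto simp: units_sheaf_inverse_closed V intro!: restrict_ext\<close>)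
    then show ?thesis
      using False f G.int_pow_neg[OF f, of 1] by (auto simp: power_int_minus)
  qed
qed

lemma omit_mem_tuples:
  assumes "ks \<in> tuples I (Suc n)" "r \<le> Suc n"
  shows "omit r ks \<in> tuples I n"
  using assms set_take_subset[of r ks] set_drop_subset[of "Suc r" ks]
  by (auto simp: tuples_def omit_def)

lemma overlap_omit: "overlap U ks \<subseteq> overlap U (omit r ks)"
  using set_take_subset[of r ks] set_drop_subset[of "Suc r" ks]
  by (auto simp: overlap_def omit_def)

lemma omit_map: "omit r (map p ks) = map p (omit r ks)"
  by (simp add: omit_def take_map drop_map)

lemma tuples_0_iff: "js \<in> tuples I 0 \<longleftrightarrow> (\<exists>a\<in>I. js = [a])"
  by (auto simp: tuples_def length_Suc_conv)

lemma tuples_1_iff: "js \<in> tuples I (Suc 0) \<longleftrightarrow> (\<exists>a\<in>I. \<exists>b\<in>I. js = [a, b])"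
  by (auto simp: tuples_def length_Suc_conv)

lemma tuples_2_iff: "js \<in> tuples I (Suc (Suc 0)) \<longleftrightarrow> (\<exists>a\<in>I. \<exists>b\<in>I. \<exists>c\<in>I. js = [a, b, c])"
  by (auto simp: tuples_def length_Suc_conv)

section \<open>The Cech complex of a family of subsets, explicit in low degrees\<close>

locale subset_family =
  fixes X :: "'a topology" and I :: "'i set" and U :: "'i \<Rightarrow> 'a set"
  assumes family_subset: "r \<in> I \<Longrightarrow> U r \<subseteq> topspace X"
begin

text \<open>A tuple of length \<open>Suc n\<close> has a head, whose set contains the overlap; the
  empty list would have overlap \<open>UNIV\<close>.\<close>

lemma overlap_subset: "js \<in> tuples I n \<Longrightarrow> overlap U js \<subseteq> topspace X"
  using family_subset by (cases js) (fastforce simp: tuples_def overlap_def)+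

lemma comm_group_units_C: "comm_group (units_C X I U n)"
  unfolding cech_cochains_def
  by (rule comm_group_product_group) (simp add: comm_group_units_sheaf overlap_subset)

lemma units_C_carrier_iff:
  "f \<in> carrier (units_C X I U n) \<longleftrightarrow>
     f \<in> extensional (tuples I n) \<and>
     (\<forall>js\<in>tuples I n. f js \<in> carrier (sections (units_sheaf X) (overlap U js)))"
  by (auto simp: cech_cochains_def PiE_iff)

lemma units_C_nonzero:
  "\<lbrakk>f \<in> carrier (units_C X I U n); js \<in> tuples I n; x \<in> overlap U js\<rbrakk> \<Longrightarrow> f js x \<noteq> 0"
  using overlap_subset by (auto simp: units_C_carrier_iff carrier_units_sheaf_iff)

lemma units_C_mult:
  "f \<otimes>\<^bsub>units_C X I U n\<^esub> g = (\<lambda>js\<in>tuples I n. \<lambda>x\<in>overlap U js. f js x * g js x)"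
  by (simp add: cech_cochains_def)

lemma units_C_one: "\<one>\<^bsub>units_C X I U n\<^esub> = (\<lambda>js\<in>tuples I n. \<lambda>x\<in>overlap U js. 1)"
  by (simp add: cech_cochains_def)

lemma units_d_factor_closed:
  assumes "f \<in> carrier (units_C X I U n)" "ks \<in> tuples I (Suc n)" "r \<le> Suc n"
  shows "restrict (f (omit r ks)) (overlap U ks) \<in> carrier (sections (units_sheaf X) (overlap U ks))"
  using units_sheaf_restrict_closed[OF overlap_subset overlap_omit] omit_mem_tuples[OF assms(2,3)]
    assms(1) by (simp add: units_C_carrier_iff)

lemma units_d_factors:
  assumes f: "f \<in> carrier (units_C X I U n)" and ks: "ks \<in> tuples I (Suc n)" and r: "r \<le> Suc n"
  shows "restrict (f (omit r ks)) (overlap U ks) [^]\<^bsub>sections (units_sheaf X) (overlap U ks)\<^esub> ((-1) ^ r :: int)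
       = (\<lambda>x\<in>overlap U ks. f (omit r ks) x powi ((-1) ^ r))"
  by (subst int_pow_sign_units_sheaf[OF overlap_subset[OF ks] units_d_factor_closed[OF assms]])
    (auto intro!: restrict_ext)

lemma units_d_factors_closed:
  assumes "f \<in> carrier (units_C X I U n)" "ks \<in> tuples I (Suc n)" "r \<le> Suc n"
  shows "(\<lambda>x\<in>overlap U ks. f (omit r ks) x powi ((-1) ^ r))
       \<in> carrier (sections (units_sheaf X) (overlap U ks))"
  unfolding units_d_factors[OF assms, symmetric]
  by (rule group.int_pow_closed[OF comm_group.axioms(2)[OF comm_group_units_sheaf]])
    (use assms in \<open>auto simp: overlap_subset units_d_factor_closed\<close>)

text \<open>The homomorphism property, the formulas in low degree and the compatibility with
  refinement are all read off from this product of reals.\<close>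

lemma units_d_pointwise:
  assumes f: "f \<in> carrier (units_C X I U n)"
  shows "units_d X I U n f =
    (\<lambda>ks\<in>tuples I (Suc n). \<lambda>x\<in>overlap U ks. \<Prod>r\<le>Suc n. f (omit r ks) x powi ((-1) ^ r))"
  unfolding cech_coboundary_def
proof (rule restrict_ext)
  fix ks assume ks: "ks \<in> tuples I (Suc n)"
  let ?S = "sections (units_sheaf X) (overlap U ks)"
  let ?g = "\<lambda>r. \<lambda>x\<in>overlap U ks. f (omit r ks) x powi ((-1) ^ r)"
  have "finprod ?S (\<lambda>r. restr (units_sheaf X) (overlap U (omit r ks)) (overlap U ks) (f (omit r ks))
          [^]\<^bsub>?S\<^esub> ((-1) ^ r :: int)) {..Suc n} = finprod ?S ?g {..Suc n}"
    by (rule comm_monoid.finprod_cong'[OF comm_group.axioms(1)[OF comm_group_units_sheaf]])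
      (use f ks in \<open>auto simp: overlap_subset units_d_factors units_d_factors_closed\<close>)
  also have "\<dots> = (\<lambda>x\<in>overlap U ks. \<Prod>r\<le>Suc n. ?g r x)"
    by (rule finprod_units_sheaf) (use f ks in \<open>auto simp: overlap_subset units_d_factors_closed\<close>)
  also have "\<dots> = (\<lambda>x\<in>overlap U ks. \<Prod>r\<le>Suc n. f (omit r ks) x powi ((-1) ^ r))"
    by (intro restrict_ext prod.cong) auto
  finally show "finprod ?S (\<lambda>r. restr (units_sheaf X) (overlap U (omit r ks)) (overlap U ks) (f (omit r ks))
          [^]\<^bsub>?S\<^esub> ((-1) ^ r :: int)) {..Suc n}
      = (\<lambda>x\<in>overlap U ks. \<Prod>r\<le>Suc n. f (omit r ks) x powi ((-1) ^ r))" .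
qed

lemma units_d_closed:
  assumes f: "f \<in> carrier (units_C X I U n)"
  shows "units_d X I U n f \<in> carrier (units_C X I U (Suc n))"
  unfolding units_C_carrier_iff
proof (intro conjI ballI)
  show "units_d X I U n f \<in> extensional (tuples I (Suc n))"
    by (simp add: cech_coboundary_def)
  fix ks assume ks: "ks \<in> tuples I (Suc n)"
  interpret S: comm_group "sections (units_sheaf X) (overlap U ks)"
    by (rule comm_group_units_sheaf[OF overlap_subset[OF ks]])
  show "units_d X I U n f ks \<in> carrier (sections (units_sheaf X) (overlap U ks))"
    unfolding cech_coboundary_def restr_units_sheaf restrict_apply'[OF ks]
    by (rule S.finprod_closed) (use f ks in \<open>auto simp: units_d_factor_closed\<close>)
qed

lemma units_d_hom: "units_d X I U n \<in> hom (units_C X I U n) (units_C X I U (Suc n))"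
proof (rule homI)
  show "units_d X I U n f \<in> carrier (units_C X I U (Suc n))" if "f \<in> carrier (units_C X I U n)" for f
    using that by (rule units_d_closed)
  fix f g assume f: "f \<in> carrier (units_C X I U n)" and g: "g \<in> carrier (units_C X I U n)"
  have fg: "f \<otimes>\<^bsub>units_C X I U n\<^esub> g \<in> carrier (units_C X I U n)"
    using f g comm_group.axioms(2)[OF comm_group_units_C] by (meson group.is_monoid monoid.m_closed)
  have "(f \<otimes>\<^bsub>units_C X I U n\<^esub> g) (omit r ks) x = f (omit r ks) x * g (omit r ks) x"
    if "ks \<in> tuples I (Suc n)" "r \<le> Suc n" "x \<in> overlap U ks" for ks r x
    using that overlap_omit[of U ks r] by (auto simp: units_C_mult omit_mem_tuples)
  then show "units_d X I U n (f \<otimes>\<^bsub>units_C X I U n\<^esub> g)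
      = units_d X I U n f \<otimes>\<^bsub>units_C X I U (Suc n)\<^esub> units_d X I U n g"
    unfolding units_d_pointwise[OF f] units_d_pointwise[OF g] units_d_pointwise[OF fg]
    unfolding units_C_mult[of "Suc n"]
    by (intro restrict_ext) (simp add: power_int_mult_distrib prod.distrib del: prod.atMost_Suc)
qed

text \<open>Omitting position 0 leaves \<open>[b]\<close> with exponent 1, omitting position 1
  leaves \<open>[a]\<close> with exponent -1.\<close>

lemma units_d_0:
  assumes "f \<in> carrier (units_C X I U 0)" "a \<in> I" "b \<in> I"
  shows "units_d X I U 0 f [a, b] = (\<lambda>x\<in>U a \<inter> U b. f [b] x * inverse (f [a] x))"
  using assms by (simp add: units_d_pointwise tuples_1_iff overlap_def omit_def power_int_minus)

lemma units_d_1: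
  assumes "f \<in> carrier (units_C X I U (Suc 0))" "a \<in> I" "b \<in> I" "c \<in> I"
  shows "units_d X I U (Suc 0) f [a, b, c]
       = (\<lambda>x\<in>U a \<inter> U b \<inter> U c. f [b, c] x * inverse (f [a, c] x) * f [a, b] x)"
  using assms
  by (simp add: units_d_pointwise tuples_2_iff overlap_def omit_def power_int_minus Int_assoc
      numeral_2_eq_2)

text \<open>Sections have no zeros, so the inverse in the coboundary can be cleared. What remains is
  the multiplicative counterpart of the parity condition for cocycles of the nerve.\<close>

lemma units_cocycles_iff:
  "f \<in> cocycles (units_C X I U) (units_d X I U) (Suc 0) \<longleftrightarrow>
     f \<in> carrier (units_C X I U (Suc 0)) \<and>
     (\<forall>a\<in>I. \<forall>b\<in>I. \<forall>c\<in>I. \<forall>x\<in>U a \<inter> U b \<inter> U c. f [b, c] x * f [a, b] x = f [a, c] x)"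
  (is "_ \<longleftrightarrow> _ \<and> ?cond")
proof (cases "f \<in> carrier (units_C X I U (Suc 0))")
  case True
  \<comment> \<open>Both sides are extensional, so they agree once they agree on tuples.\<close>
  have "units_d X I U (Suc 0) f = \<one>\<^bsub>units_C X I U (Suc (Suc 0))\<^esub> \<longleftrightarrow>
    (\<forall>ks\<in>tuples I (Suc (Suc 0)). units_d X I U (Suc 0) f ks = \<one>\<^bsub>units_C X I U (Suc (Suc 0))\<^esub> ks)"
    by (auto simp: cech_coboundary_def units_C_one fun_eq_iff restrict_def)
  also have "\<dots> \<longleftrightarrow> (\<forall>a\<in>I. \<forall>b\<in>I. \<forall>c\<in>I.
      units_d X I U (Suc 0) f [a, b, c] = \<one>\<^bsub>units_C X I U (Suc (Suc 0))\<^esub> [a, b, c])"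
    by (auto simp: tuples_2_iff)
  also have "\<dots> \<longleftrightarrow> (\<forall>a\<in>I. \<forall>b\<in>I. \<forall>c\<in>I. \<forall>x\<in>U a \<inter> U b \<inter> U c.
      f [b, c] x * inverse (f [a, c] x) * f [a, b] x = 1)"
    by (intro ball_cong refl)
      (simp add: tuples_2_iff units_d_1[OF True] units_C_one overlap_def restrict_eq_restrict_iff
        Int_assoc)
  also have "\<dots> \<longleftrightarrow> ?cond"
  proof -
    have "f [a, c] x \<noteq> 0" if "a \<in> I" "c \<in> I" "x \<in> U a \<inter> U c" for a c x
      using units_C_nonzero[OF True] that by (simp add: tuples_1_iff overlap_def)
    moreover have "u * inverse z * v = 1 \<longleftrightarrow> u * v = z" if "z \<noteq> 0" for u v z :: real
      using that by (auto simp: field_simps)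
    ultimately show ?thesis by (intro ball_cong refl) simp
  qed
  finally show ?thesis
    using True by (simp add: cocycles_def kernel_def)
next
  case False
  then show ?thesis by (simp add: cocycles_def kernel_def)
qed

text \<open>The quotients telescope: \<open>(f_c / f_b) * (f_b / f_a) = f_c / f_a\<close> on a
  triple overlap.\<close>

lemma units_d_d_0:
  assumes f: "f \<in> carrier (units_C X I U 0)"
  shows "units_d X I U 0 f \<in> cocycles (units_C X I U) (units_d X I U) (Suc 0)"
proof -
  have "f [a] x \<noteq> 0" if "a \<in> I" "x \<in> U a" for a x
    using units_C_nonzero[OF f] that by (simp add: tuples_0_iff overlap_def)
  then show ?thesis
    using f by (auto simp: units_cocycles_iff units_d_closed units_d_0 field_simps)
qed

lemma cochain_segment_units: "cochain_segment (units_C X I U) (units_d X I U) 0"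
proof (rule cochain_segment.intro)
  show "units_d X I U (Suc 0) (units_d X I U 0 f) = \<one>\<^bsub>units_C X I U (Suc (Suc 0))\<^esub>"
    if "f \<in> carrier (units_C X I U 0)" for f
    using units_d_d_0[OF that] by (simp add: cocycles_def kernel_def)
qed (rule comm_group_units_C units_d_hom)+

end


section \<open>Pullback of Cech cochains along a refining map\<close>

locale refined_family =
  coarse: subset_family X I U + fine: subset_family X J V
  for X :: "'a topology" and I :: "'i set" and U and J :: "'j set" and V +
  fixes p :: "'j \<Rightarrow> 'i"
  assumes refining: "refining_map J V I U p"
begin

lemma map_mem_tuples: "js \<in> tuples J n \<Longrightarrow> map p js \<in> tuples I n"
  using refining by (auto simp: tuples_def refining_map_def)

lemma overlap_map: "js \<in> tuples J n \<Longrightarrow> overlap V js \<subseteq> overlap U (map p js)"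
  using refining by (fastforce simp: tuples_def refining_map_def overlap_def)

lemma cech_pullback_closed:
  assumes "f \<in> carrier (units_C X I U n)"
  shows "cech_pullback (units_sheaf X) U J V p n f \<in> carrier (units_C X J V n)"
  unfolding fine.units_C_carrier_iff
proof (intro conjI ballI)
  fix js assume js: "js \<in> tuples J n"
  show "cech_pullback (units_sheaf X) U J V p n f js
      \<in> carrier (sections (units_sheaf X) (overlap V js))"
    using units_sheaf_restrict_closed[OF coarse.overlap_subset overlap_map[OF js]]
      map_mem_tuples[OF js] assms js
    by (simp add: cech_pullback_def coarse.units_C_carrier_iff)
qed (simp add: cech_pullback_def)

lemma cech_pullback_apply:
  assumes "js \<in> tuples J n"
  shows "cech_pullback (units_sheaf X) U J V p n f js = (\<lambda>x\<in>overlap V js. f (map p js) x)"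
  using assms by (auto simp: cech_pullback_def)

lemma cech_pullback_hom:
  "cech_pullback (units_sheaf X) U J V p n \<in> hom (units_C X I U n) (units_C X J V n)"
proof (rule homI)
  fix f g
  show "cech_pullback (units_sheaf X) U J V p n (f \<otimes>\<^bsub>units_C X I U n\<^esub> g)
      = cech_pullback (units_sheaf X) U J V p n f
        \<otimes>\<^bsub>units_C X J V n\<^esub> cech_pullback (units_sheaf X) U J V p n g"
    unfolding fine.units_C_mult cech_pullback_def[of _ _ _ _ _ _ "f \<otimes>\<^bsub>units_C X I U n\<^esub> g"]
    using overlap_map
    by (intro restrict_ext)
      (auto simp: cech_pullback_apply coarse.units_C_mult map_mem_tuples fun_eq_iff
        restrict_def subset_iff)
qed (rule cech_pullback_closed)

text \<open>Omitting an entry commutes with applying \<open>p\<close> to every entry, and each point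
  of the fine overlap already lies in the coarse one, so both sides are the same alternating
  product.\<close>

lemma cech_pullback_coboundary:
  assumes f: "f \<in> carrier (units_C X I U n)"
  shows "cech_pullback (units_sheaf X) U J V p (Suc n) (units_d X I U n f)
       = units_d X J V n (cech_pullback (units_sheaf X) U J V p n f)"
  unfolding fine.units_d_pointwise[OF cech_pullback_closed[OF f]]
    cech_pullback_def[of _ _ _ _ _ "Suc n"]
proof (rule restrict_ext)
  fix ks assume ks: "ks \<in> tuples J (Suc n)"
  have eq: "cech_pullback (units_sheaf X) U J V p n f (omit r ks) x = f (omit r (map p ks)) x"
    if "r \<le> Suc n" "x \<in> overlap V ks" for r x
    using that overlap_omit[of V ks r] ks
    by (auto simp: cech_pullback_apply[OF omit_mem_tuples] omit_map)
  have "x \<in> overlap U (map p ks)" if "x \<in> overlap V ks" for x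
    using that overlap_map[OF ks] by blast
  then show "restr (units_sheaf X) (overlap U (map p ks)) (overlap V ks) (units_d X I U n f (map p ks))
      = (\<lambda>x\<in>overlap V ks. \<Prod>r\<le>Suc n. cech_pullback (units_sheaf X) U J V p n f (omit r ks) x
           powi ((-1) ^ r))"
    unfolding restr_units_sheaf
    by (intro restrict_ext)
      (simp add: coarse.units_d_pointwise[OF f] map_mem_tuples[OF ks] eq del: prod.atMost_Suc)
qed

lemma cochain_map_cech_pullback:
  "cochain_map (units_C X I U) (units_d X I U) (units_C X J V) (units_d X J V) 0
     (cech_pullback (units_sheaf X) U J V p (Suc 0))"
proof (intro cochain_map.intro cochain_map_axioms.intro coarse.cochain_segment_units
    fine.cochain_segment_units cech_pullback_hom)
  fix f assume "f \<in> cocycles (units_C X I U) (units_d X I U) (Suc 0)"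
  then have f: "f \<in> carrier (units_C X I U (Suc 0))"
    and df: "units_d X I U (Suc 0) f = \<one>\<^bsub>units_C X I U (Suc (Suc 0))\<^esub>"
    by (auto simp: cocycles_def kernel_def)
  have "units_d X J V (Suc 0) (cech_pullback (units_sheaf X) U J V p (Suc 0) f)
      = \<one>\<^bsub>units_C X J V (Suc (Suc 0))\<^esub>"
    unfolding cech_pullback_coboundary[OF f, symmetric] df
    by (rule hom_one[OF cech_pullback_hom])
      (simp_all add: comm_group.axioms coarse.comm_group_units_C fine.comm_group_units_C)
  then show "cech_pullback (units_sheaf X) U J V p (Suc 0) f
      \<in> cocycles (units_C X J V) (units_d X J V) (Suc 0)"
    using cech_pullback_closed[OF f] by (simp add: cocycles_def kernel_def)
next
  fix f assume "f \<in> coboundaries (units_C X I U) (units_d X I U) (Suc 0)"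
  then show "cech_pullback (units_sheaf X) U J V p (Suc 0) f
      \<in> coboundaries (units_C X J V) (units_d X J V) (Suc 0)"
    by (auto simp: coboundaries_def cech_pullback_coboundary cech_pullback_closed)
qed

end


section \<open>Cocycles of the nerve modulo 2\<close>

text \<open>An index whose set is empty gives no vertex, so a function on \<open>I\<close> and a
  0-cochain are not quite the same thing.\<close>

lemma simplex_0_iff: "\<sigma> \<in> simplices (nerve I U) 0 \<longleftrightarrow> (\<exists>a\<in>I. U a \<noteq> {} \<and> \<sigma> = {a})"
  by (auto simp: simplices_def nerve_def card_Suc_eq)

lemma simplex_1I:
  assumes "a \<in> I" "b \<in> I" "a \<noteq> b" "U a \<inter> U b \<noteq> {}"
  shows "{a, b} \<in> simplices (nerve I U) (Suc 0)"
  using assms by (simp add: simplices_def nerve_def)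

lemma simplex_1_iff:
  "\<sigma> \<in> simplices (nerve I U) (Suc 0) \<longleftrightarrow>
     (\<exists>a\<in>I. \<exists>b\<in>I. a \<noteq> b \<and> U a \<inter> U b \<noteq> {} \<and> \<sigma> = {a, b})"
  (is "_ \<longleftrightarrow> ?R")
proof
  assume \<sigma>: "\<sigma> \<in> simplices (nerve I U) (Suc 0)"
  then have "card \<sigma> = 2" by (simp add: simplices_def)
  then obtain a b where ab: "\<sigma> = {a, b}" "a \<noteq> b"
    unfolding card_2_iff by blast
  then have "a \<in> I" "b \<in> I" "U a \<inter> U b \<noteq> {}"
    using \<sigma> by (simp_all add: simplices_def nerve_def)
  then show ?R using ab by blast
next
  assume ?R
  then obtain a b where ab: "a \<in> I" "b \<in> I" "a \<noteq> b" "U a \<inter> U b \<noteq> {}" and \<sigma>: "\<sigma> = {a, b}"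
    by blast
  show "\<sigma> \<in> simplices (nerve I U) (Suc 0)"
    unfolding \<sigma> using ab by (rule simplex_1I)
qed

lemma simplex_2I:
  assumes "a \<in> I" "b \<in> I" "c \<in> I" "a \<noteq> b" "a \<noteq> c" "b \<noteq> c" "U a \<inter> U b \<inter> U c \<noteq> {}"
  shows "{a, b, c} \<in> simplices (nerve I U) (Suc (Suc 0))"
  using assms by (simp add: simplices_def nerve_def Int_assoc)

lemma simplex_2_iff:
  "\<sigma> \<in> simplices (nerve I U) (Suc (Suc 0)) \<longleftrightarrow>
     (\<exists>a\<in>I. \<exists>b\<in>I. \<exists>c\<in>I. a \<noteq> b \<and> a \<noteq> c \<and> b \<noteq> c \<and> U a \<inter> U b \<inter> U c \<noteq> {} \<and> \<sigma> = {a, b, c})"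
  (is "_ \<longleftrightarrow> ?R")
proof
  assume \<sigma>: "\<sigma> \<in> simplices (nerve I U) (Suc (Suc 0))"
  then have "card \<sigma> = 3" by (simp add: simplices_def)
  then obtain a b c where abc: "\<sigma> = {a, b, c}" "a \<noteq> b" "b \<noteq> c" "a \<noteq> c"
    unfolding card_3_iff by blast
  then have "a \<in> I" "b \<in> I" "c \<in> I" "U a \<inter> U b \<inter> U c \<noteq> {}"
    using \<sigma> by (simp_all add: simplices_def nerve_def Int_assoc)
  then show ?R using abc by blast
next
  assume ?R
  then obtain a b c where abc: "a \<in> I" "b \<in> I" "c \<in> I" "a \<noteq> b" "a \<noteq> c" "b \<noteq> c"
    "U a \<inter> U b \<inter> U c \<noteq> {}" and \<sigma>: "\<sigma> = {a, b, c}"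
    by blast
  show "\<sigma> \<in> simplices (nerve I U) (Suc (Suc 0))"
    unfolding \<sigma> using abc by (rule simplex_2I)
qed

lemma simplex_face:
  assumes "\<sigma> \<in> simplices (nerve I U) (Suc k)" "v \<in> \<sigma>"
  shows "\<sigma> - {v} \<in> simplices (nerve I U) k"
proof -
  have \<sigma>: "finite \<sigma>" "\<sigma> \<subseteq> I" "(\<Inter>r\<in>\<sigma>. U r) \<noteq> {}" "card \<sigma> = Suc (Suc k)"
    using assms(1) by (auto simp: simplices_def nerve_def)
  have card: "card (\<sigma> - {v}) = Suc k"
    using \<sigma> assms(2) by simp
  then have "\<sigma> - {v} \<noteq> {}" by (metis card.empty nat.distinct(1))
  moreover have "(\<Inter>r\<in>\<sigma>. U r) \<subseteq> (\<Inter>r\<in>\<sigma> - {v}. U r)" by blast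
  ultimately show ?thesis
    using \<sigma> card by (auto simp: simplices_def nerve_def)
qed

lemma nerve_C_carrier_iff:
  "c \<in> carrier (nerve_C I U k) \<longleftrightarrow>
     c \<in> extensional (simplices (nerve I U) k) \<and> (\<forall>\<sigma>\<in>simplices (nerve I U) k. c \<sigma> \<in> {0..<2})"
  by (auto simp: simplicial_cochains_def PiE_iff carrier_integer_mod_group)

lemma nerve_C_mult:
  "c \<otimes>\<^bsub>nerve_C I U k\<^esub> c' = (\<lambda>\<sigma>\<in>simplices (nerve I U) k. (c \<sigma> + c' \<sigma>) mod 2)"
  by (simp add: simplicial_cochains_def)

lemma nerve_C_one: "\<one>\<^bsub>nerve_C I U k\<^esub> = (\<lambda>\<sigma>\<in>simplices (nerve I U) k. 0)"
  by (simp add: simplicial_cochains_def)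

lemma comm_group_nerve_C: "comm_group (nerve_C I U k)"
  unfolding simplicial_cochains_def by (rule comm_group_product_group) simp

lemma nerve_d_hom: "nerve_d I U k \<in> hom (nerve_C I U k) (nerve_C I U (Suc k))"
proof (rule homI)
  fix c c'
  show "nerve_d I U k (c \<otimes>\<^bsub>nerve_C I U k\<^esub> c')
      = nerve_d I U k c \<otimes>\<^bsub>nerve_C I U (Suc k)\<^esub> nerve_d I U k c'"
    unfolding nerve_C_mult[of I U "Suc k"] simplicial_coboundary_def[of _ _ "c \<otimes>\<^bsub>nerve_C I U k\<^esub> c'"]
  proof (rule restrict_ext)
    fix \<sigma> assume \<sigma>: "\<sigma> \<in> simplices (nerve I U) (Suc k)"
    have "(\<Sum>v\<in>\<sigma>. (c \<otimes>\<^bsub>nerve_C I U k\<^esub> c') (\<sigma> - {v})) mod 2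
        = (\<Sum>v\<in>\<sigma>. (c (\<sigma> - {v}) + c' (\<sigma> - {v})) mod 2) mod 2"
      using simplex_face[OF \<sigma>] by (intro arg_cong[where f = "\<lambda>n. n mod 2"] sum.cong refl) (simp add: nerve_C_mult)
    also have "\<dots> = ((\<Sum>v\<in>\<sigma>. c (\<sigma> - {v})) mod 2 + (\<Sum>v\<in>\<sigma>. c' (\<sigma> - {v})) mod 2) mod 2"
      by (simp only: mod_sum_eq sum.distrib mod_add_eq)
    finally show "(\<Sum>v\<in>\<sigma>. (c \<otimes>\<^bsub>nerve_C I U k\<^esub> c') (\<sigma> - {v})) mod 2
        = (nerve_d I U k c \<sigma> + nerve_d I U k c' \<sigma>) mod 2"
      using \<sigma> by (simp add: simplicial_coboundary_def)
  qed
qed (simp add: nerve_C_carrier_iff simplicial_coboundary_def)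

lemma nerve_d_0:
  assumes "a \<in> I" "b \<in> I" "a \<noteq> b" "U a \<inter> U b \<noteq> {}"
  shows "nerve_d I U 0 c {a, b} = (c {a} + c {b}) mod 2"
proof -
  have "{a, b} \<in> simplices (nerve I U) (Suc 0)" using assms by (intro simplex_1I)
  moreover have "{a, b} - {a} = {b}" "{a, b} - {b} = {a}" using assms by auto
  ultimately show ?thesis using assms by (simp add: simplicial_coboundary_def add.commute)
qed

lemma nerve_d_1:
  fixes I :: "'i set"
  assumes "a \<in> I" "b \<in> I" "c \<in> I" "a \<noteq> b" "a \<noteq> c" "b \<noteq> c" "U a \<inter> U b \<inter> U c \<noteq> {}"
  shows "nerve_d I U (Suc 0) \<tau> {a, b, c}
       = (edge_value \<tau> b c + edge_value \<tau> a c + edge_value \<tau> a b) mod 2"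
proof -
  have mem: "{a, b, c} \<in> simplices (nerve I U) (Suc (Suc 0))"
    using assms by (rule simplex_2I)
  have sum: "sum g {a, b, c} = g a + g b + g c" for g :: "'i \<Rightarrow> int"
    using assms(4-6) by simp
  have faces: "{a, b, c} - {a} = {b, c}" "{a, b, c} - {b} = {a, c}" "{a, b, c} - {c} = {a, b}"
    using assms(4-6) by auto
  show ?thesis
    unfolding simplicial_coboundary_def restrict_apply'[OF mem] sum faces edge_value_def
    using assms(4-6) by simp
qed

lemma edge_value_commute: "edge_value \<tau> a b = edge_value \<tau> b a"
  by (simp add: edge_value_def insert_commute)

lemma edge_value_self [simp]: "edge_value \<tau> a a = 0"
  by (simp add: edge_value_def)

text \<open>The condition runs over all triples, as it does for Cech cocycles. If two of the indices
  coincide, one edge value is zero and the other two are equal by symmetry, so the sum is even for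
  any \<open>\<tau>\<close>; only genuine triangles contribute.\<close>

lemma nerve_cocycles_iff:
  "\<tau> \<in> cocycles (nerve_C I U) (nerve_d I U) (Suc 0) \<longleftrightarrow>
     \<tau> \<in> carrier (nerve_C I U (Suc 0)) \<and>
     (\<forall>a\<in>I. \<forall>b\<in>I. \<forall>c\<in>I. U a \<inter> U b \<inter> U c \<noteq> {} \<longrightarrow>
        even (edge_value \<tau> b c + edge_value \<tau> a c + edge_value \<tau> a b))"
  (is "_ \<longleftrightarrow> _ \<and> ?cond")
proof -
  have "nerve_d I U (Suc 0) \<tau> = \<one>\<^bsub>nerve_C I U (Suc (Suc 0))\<^esub> \<longleftrightarrow>
    (\<forall>\<sigma>\<in>simplices (nerve I U) (Suc (Suc 0)). nerve_d I U (Suc 0) \<tau> \<sigma> = 0)"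
    by (auto simp: simplicial_coboundary_def nerve_C_one fun_eq_iff restrict_def)
  also have "\<dots> \<longleftrightarrow> ?cond"
  proof
    assume d: "\<forall>\<sigma>\<in>simplices (nerve I U) (Suc (Suc 0)). nerve_d I U (Suc 0) \<tau> \<sigma> = 0"
    show ?cond
    proof (intro ballI impI)
      fix a b c assume abc: "a \<in> I" "b \<in> I" "c \<in> I" "U a \<inter> U b \<inter> U c \<noteq> {}"
      show "even (edge_value \<tau> b c + edge_value \<tau> a c + edge_value \<tau> a b)"
      proof (cases "a \<noteq> b \<and> a \<noteq> c \<and> b \<noteq> c")
        case True
        then have "{a, b, c} \<in> simplices (nerve I U) (Suc (Suc 0))"
          using abc by (intro simplex_2I) auto
        then show ?thesis using d nerve_d_1[of a I b c U \<tau>] abc True by auto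
      qed (auto simp: edge_value_commute)
    qed
  next
    assume even: ?cond
    show "\<forall>\<sigma>\<in>simplices (nerve I U) (Suc (Suc 0)). nerve_d I U (Suc 0) \<tau> \<sigma> = 0"
    proof
      fix \<sigma> assume "\<sigma> \<in> simplices (nerve I U) (Suc (Suc 0))"
      then obtain a b c where abc: "a \<in> I" "b \<in> I" "c \<in> I" "a \<noteq> b" "a \<noteq> c" "b \<noteq> c"
        "U a \<inter> U b \<inter> U c \<noteq> {}" and \<sigma>: "\<sigma> = {a, b, c}"
        unfolding simplex_2_iff by blast
      have "even (edge_value \<tau> b c + edge_value \<tau> a c + edge_value \<tau> a b)"
        using even abc by blast
      then show "nerve_d I U (Suc 0) \<tau> \<sigma> = 0"
        unfolding \<sigma> nerve_d_1[of a I b c U \<tau>, OF abc] by (simp only: even_iff_mod_2_eq_zero)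
    qed
  qed
  finally show ?thesis by (simp add: cocycles_def kernel_def)
qed

text \<open>Only parities matter, so the bounding 0-cochain may be any integer function on indices,
  without regard to range or to indices that are not vertices. In this form it can be composed with
  a refining map or built from signs of functions.\<close>

lemma nerve_coboundaries_iff:
  "\<tau> \<in> coboundaries (nerve_C I U) (nerve_d I U) (Suc 0) \<longleftrightarrow>
     \<tau> \<in> carrier (nerve_C I U (Suc 0)) \<and>
     (\<exists>c :: 'i \<Rightarrow> int. \<forall>a\<in>I. \<forall>b\<in>I. U a \<inter> U b \<noteq> {} \<longrightarrow> even (edge_value \<tau> a b + c a + c b))"
  (is "_ \<longleftrightarrow> _ \<and> ?cond")
proof
  assume "\<tau> \<in> coboundaries (nerve_C I U) (nerve_d I U) (Suc 0)"
  then obtain c where c: "c \<in> carrier (nerve_C I U 0)" "\<tau> = nerve_d I U 0 c"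
    by (auto simp: coboundaries_def)
  have "even (edge_value \<tau> a b + c {a} + c {b})"
    if "a \<in> I" "b \<in> I" "U a \<inter> U b \<noteq> {}" for a b
    using that by (cases "a = b") (auto simp: c edge_value_def nerve_d_0)
  then show "\<tau> \<in> carrier (nerve_C I U (Suc 0)) \<and> ?cond"
    using c hom_in_carrier[OF nerve_d_hom] by (auto intro!: exI[of _ "\<lambda>a. c {a}"])
next
  assume "\<tau> \<in> carrier (nerve_C I U (Suc 0)) \<and> ?cond"
  then obtain c where \<tau>: "\<tau> \<in> carrier (nerve_C I U (Suc 0))"
    and c: "\<And>a b. a \<in> I \<Longrightarrow> b \<in> I \<Longrightarrow> U a \<inter> U b \<noteq> {} \<Longrightarrow> even (edge_value \<tau> a b + c a + c b)"
    by blast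
  \<comment> \<open>\<open>the_elem\<close> recovers the vertex from its singleton simplex, and
    reduction modulo 2 brings the value into the coefficient group.\<close>
  define c0 where "c0 = (\<lambda>\<sigma>\<in>simplices (nerve I U) 0. c (the_elem \<sigma>) mod 2)"
  have "\<tau> = nerve_d I U 0 c0"
  proof (rule extensionalityI)
    fix \<sigma> assume \<sigma>: "\<sigma> \<in> simplices (nerve I U) (Suc 0)"
    then obtain a b where ab: "a \<in> I" "b \<in> I" "a \<noteq> b" "U a \<inter> U b \<noteq> {}" "\<sigma> = {a, b}"
      by (auto simp: simplex_1_iff)
    have "c0 {a} = c a mod 2" "c0 {b} = c b mod 2"
      using ab by (auto simp: c0_def simplex_0_iff)
    then have "nerve_d I U 0 c0 \<sigma> = (c a + c b) mod 2"
      using ab by (simp add: nerve_d_0 mod_add_eq)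
    moreover have "even (\<tau> \<sigma> + c a + c b)"
      using c[of a b] ab by (simp add: edge_value_def)
    moreover have "\<tau> \<sigma> \<in> {0..<2}"
      using \<tau> \<sigma> by (simp add: nerve_C_carrier_iff)
    then have "\<tau> \<sigma> = 0 \<or> \<tau> \<sigma> = 1" by auto
    ultimately show "\<tau> \<sigma> = nerve_d I U 0 c0 \<sigma>"
      by (auto simp: mod_2_eq_odd)
  qed (use \<tau> in \<open>auto simp: nerve_C_carrier_iff simplicial_coboundary_def\<close>)
  moreover have "c0 \<in> carrier (nerve_C I U 0)"
    by (simp add: nerve_C_carrier_iff c0_def)
  ultimately show "\<tau> \<in> coboundaries (nerve_C I U) (nerve_d I U) (Suc 0)"
    by (auto simp: coboundaries_def)
qed

text \<open>Each edge value of a coboundary has the parity of the sum over its two endpoints, and in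
  a triangle every vertex is counted twice.\<close>

lemma cochain_segment_nerve: "cochain_segment (nerve_C I U) (nerve_d I U) 0"
proof (rule cochain_segment.intro)
  fix c assume c: "c \<in> carrier (nerve_C I U 0)"
  have e: "even (edge_value (nerve_d I U 0 c) a b + c {a} + c {b})"
    if "a \<in> I" "b \<in> I" "U a \<inter> U b \<noteq> {}" for a b
    using that by (cases "a = b") (auto simp: edge_value_def nerve_d_0)
  have "nerve_d I U 0 c \<in> cocycles (nerve_C I U) (nerve_d I U) (Suc 0)"
    unfolding nerve_cocycles_iff
  proof (intro conjI ballI impI)
    fix x y z assume xyz: "x \<in> I" "y \<in> I" "z \<in> I" "U x \<inter> U y \<inter> U z \<noteq> {}"
    then have "U y \<inter> U z \<noteq> {}" "U x \<inter> U z \<noteq> {}" "U x \<inter> U y \<noteq> {}" by auto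
    then show "even (edge_value (nerve_d I U 0 c) y z + edge_value (nerve_d I U 0 c) x z
        + edge_value (nerve_d I U 0 c) x y)"
      using e[of y z] e[of x z] e[of x y] xyz unfolding even_add by argo
  qed (rule hom_in_carrier[OF nerve_d_hom c])
  then show "nerve_d I U (Suc 0) (nerve_d I U 0 c) = \<one>\<^bsub>nerve_C I U (Suc (Suc 0))\<^esub>"
    by (simp add: cocycles_def kernel_def)
qed (rule comm_group_nerve_C nerve_d_hom)+

section \<open>Pullback of nerve cochains along a refining map\<close>

lemma simplex_image:
  assumes "refining_map J V I U p" "\<sigma> \<in> simplices (nerve J V) k" "card (p ` \<sigma>) = card \<sigma>"
  shows "p ` \<sigma> \<in> simplices (nerve I U) k"
proof -
  have \<sigma>: "finite \<sigma>" "\<sigma> \<noteq> {}" "\<sigma> \<subseteq> J" "(\<Inter>s\<in>\<sigma>. V s) \<noteq> {}" "card \<sigma> = Suc k"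
    using assms(2) by (auto simp: simplices_def nerve_def)
  have mono: "p s \<in> I" "V s \<subseteq> U (p s)" if "s \<in> \<sigma>" for s
    using assms(1) \<sigma>(3) that unfolding refining_map_def by blast+
  obtain x where "\<And>s. s \<in> \<sigma> \<Longrightarrow> x \<in> V s" using \<sigma>(4) by blast
  then have "x \<in> (\<Inter>r\<in>p ` \<sigma>. U r)" using mono(2) by blast
  then have "(\<Inter>r\<in>p ` \<sigma>. U r) \<noteq> {}" by blast
  moreover have "p ` \<sigma> \<subseteq> I" using mono(1) by blast
  ultimately show ?thesis
    using \<sigma>(1,2,5) assms(3) unfolding simplices_def nerve_def by simp
qed

lemma simplicial_pullback_hom:
  assumes "refining_map J V I U p"
  shows "simplicial_pullback (nerve J V) p k \<in> hom (nerve_C I U k) (nerve_C J V k)"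
proof (rule homI)
  fix c c'
  show "simplicial_pullback (nerve J V) p k c \<in> carrier (nerve_C J V k)"
    if c: "c \<in> carrier (nerve_C I U k)"
    unfolding nerve_C_carrier_iff
  proof (intro conjI ballI)
    fix \<sigma> assume \<sigma>: "\<sigma> \<in> simplices (nerve J V) k"
    show "simplicial_pullback (nerve J V) p k c \<sigma> \<in> {0..<2}"
    proof (cases "card (p ` \<sigma>) = card \<sigma>")
      case True
      with c simplex_image[OF assms \<sigma>] have "c (p ` \<sigma>) \<in> {0..<2}"
        unfolding nerve_C_carrier_iff by blast
      with True \<sigma> show ?thesis by (simp add: simplicial_pullback_def)
    qed (use \<sigma> in \<open>simp add: simplicial_pullback_def\<close>)
  qed (simp add: simplicial_pullback_def)
  show "simplicial_pullback (nerve J V) p k (c \<otimes>\<^bsub>nerve_C I U k\<^esub> c')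
      = simplicial_pullback (nerve J V) p k c \<otimes>\<^bsub>nerve_C J V k\<^esub> simplicial_pullback (nerve J V) p k c'"
  proof (rule extensionalityI)
    fix \<sigma> assume \<sigma>: "\<sigma> \<in> simplices (nerve J V) k"
    then show "simplicial_pullback (nerve J V) p k (c \<otimes>\<^bsub>nerve_C I U k\<^esub> c') \<sigma>
        = (simplicial_pullback (nerve J V) p k c
            \<otimes>\<^bsub>nerve_C J V k\<^esub> simplicial_pullback (nerve J V) p k c') \<sigma>"
      using simplex_image[OF assms \<sigma>] by (simp add: nerve_C_mult simplicial_pullback_def)
  qed (simp_all add: nerve_C_mult simplicial_pullback_def)
qed

text \<open>When \<open>p\<close> collapses the edge, the pullback is zero by convention and
  \<open>edge_value\<close> is zero on the diagonal, so one formula covers both cases. The overlap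
  must be nonempty, as otherwise the pair may not be an edge and the pullback is unspecified
  there.\<close>

lemma edge_value_pullback:
  assumes "s \<in> J" "t \<in> J" "V s \<inter> V t \<noteq> {}"
  shows "edge_value (simplicial_pullback (nerve J V) p (Suc 0) \<tau>) s t = edge_value \<tau> (p s) (p t)"
proof (cases "s = t")
  case False
  then have "{s, t} \<in> simplices (nerve J V) (Suc 0)"
    using assms by (intro simplex_1I)
  then show ?thesis
    using False by (auto simp: edge_value_def simplicial_pullback_def card_insert_if)
qed simp

text \<open>The parity criteria are transported along \<open>p\<close> instead of comparing
  coboundaries face by face. A common point of the fine sets is common to the coarse ones, and a
  triple that becomes degenerate under \<open>p\<close> is still covered by the cocycle
  criterion.\<close>

lemma cochain_map_simplicial_pullback:
  fixes J :: "'j set"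
  assumes p: "refining_map J V I U p"
  shows "cochain_map (nerve_C I U) (nerve_d I U) (nerve_C J V) (nerve_d J V) 0
     (simplicial_pullback (nerve J V) p (Suc 0))"
proof (intro cochain_map.intro cochain_map_axioms.intro cochain_segment_nerve
    simplicial_pullback_hom[OF p])
  have mono: "p s \<in> I" "V s \<subseteq> U (p s)" if "s \<in> J" for s
    using p that by (auto simp: refining_map_def)
  show "simplicial_pullback (nerve J V) p (Suc 0) \<tau> \<in> cocycles (nerve_C J V) (nerve_d J V) (Suc 0)"
    if "\<tau> \<in> cocycles (nerve_C I U) (nerve_d I U) (Suc 0)" for \<tau>
    unfolding nerve_cocycles_iff
  proof (intro conjI ballI impI)
    fix a b c assume abc: "a \<in> J" "b \<in> J" "c \<in> J" "V a \<inter> V b \<inter> V c \<noteq> {}"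
    then have "V b \<inter> V c \<noteq> {}" "V a \<inter> V c \<noteq> {}" "V a \<inter> V b \<noteq> {}" by auto
    moreover have "U (p a) \<inter> U (p b) \<inter> U (p c) \<noteq> {}" using abc mono(2) by blast
    moreover have "even (edge_value \<tau> (p b) (p c) + edge_value \<tau> (p a) (p c)
        + edge_value \<tau> (p a) (p b))"
      using that abc mono(1) calculation unfolding nerve_cocycles_iff by blast
    ultimately show "even (edge_value (simplicial_pullback (nerve J V) p (Suc 0) \<tau>) b c
        + edge_value (simplicial_pullback (nerve J V) p (Suc 0) \<tau>) a c
        + edge_value (simplicial_pullback (nerve J V) p (Suc 0) \<tau>) a b)"
      using abc by (simp only: edge_value_pullback simp_thms)
  next
    show "simplicial_pullback (nerve J V) p (Suc 0) \<tau> \<in> carrier (nerve_C J V (Suc 0))"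
      using that hom_in_carrier[OF simplicial_pullback_hom[OF p]] unfolding nerve_cocycles_iff
      by blast
  qed
  show "simplicial_pullback (nerve J V) p (Suc 0) \<tau> \<in> coboundaries (nerve_C J V) (nerve_d J V) (Suc 0)"
    if \<tau>: "\<tau> \<in> coboundaries (nerve_C I U) (nerve_d I U) (Suc 0)" for \<tau>
  proof -
    obtain c where c: "\<And>a b. a \<in> I \<Longrightarrow> b \<in> I \<Longrightarrow> U a \<inter> U b \<noteq> {} \<Longrightarrow> even (edge_value \<tau> a b + c a + c b)"
      using \<tau> unfolding nerve_coboundaries_iff by blast
    have "even (edge_value (simplicial_pullback (nerve J V) p (Suc 0) \<tau>) s t + c (p s) + c (p t))"
      if st: "s \<in> J" "t \<in> J" "V s \<inter> V t \<noteq> {}" for s t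
    proof -
      have "U (p s) \<inter> U (p t) \<noteq> {}" using st mono(2) by blast
      then show ?thesis
        unfolding edge_value_pullback[OF st] using c mono(1) st by blast
    qed
    then have "\<exists>c :: 'j \<Rightarrow> int. \<forall>s\<in>J. \<forall>t\<in>J. V s \<inter> V t \<noteq> {} \<longrightarrow>
        even (edge_value (simplicial_pullback (nerve J V) p (Suc 0) \<tau>) s t + c s + c t)"
      \<comment> \<open>The bounding function of the pullback is the old one composed with
        \<open>p\<close>.\<close>
      by (intro exI[of _ "\<lambda>s. c (p s)"]) blast
    moreover have "simplicial_pullback (nerve J V) p (Suc 0) \<tau> \<in> carrier (nerve_C J V (Suc 0))"
      using \<tau> hom_in_carrier[OF simplicial_pullback_hom[OF p]] unfolding nerve_coboundaries_iff
      by blast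
    ultimately show ?thesis unfolding nerve_coboundaries_iff by blast
  qed
qed


section \<open>The comparison map\<close>

lemma power_int_minus_one: "(-1 :: real) powi k = (if even k then 1 else -1)"
  by simp

lemma sign_cochain_apply:
  assumes "a \<in> I" "b \<in> I"
  shows "sign_cochain I U \<tau> [a, b] = (\<lambda>x\<in>U a \<inter> U b. (-1) powi edge_value \<tau> a b)"
  using assms by (simp add: sign_cochain_def tuples_1_iff overlap_def)

lemma edge_value_mult:
  assumes "a \<in> I" "b \<in> I" "U a \<inter> U b \<noteq> {}"
  shows "edge_value (\<tau> \<otimes>\<^bsub>nerve_C I U (Suc 0)\<^esub> \<tau>') a b = (edge_value \<tau> a b + edge_value \<tau>' a b) mod 2"
proof (cases "a = b")
  case False
  then have "{a, b} \<in> simplices (nerve I U) (Suc 0)"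
    using assms by (intro simplex_1I)
  then show ?thesis
    using False by (simp add: edge_value_def nerve_C_mult)
qed simp

text \<open>Intermediate values: the image of \<open>V\<close> is a connected set of reals, so with
  values of both signs it would contain 0.\<close>

lemma connected_nonzero_sign:
  fixes f :: "'a \<Rightarrow> real"
  assumes "connectedin X V" "f \<in> carrier (sections (units_sheaf X) V)" "x \<in> V" "y \<in> V"
  shows "f x < 0 \<longleftrightarrow> f y < 0"
proof -
  have V: "V \<subseteq> topspace X" using assms(1) by (rule connectedin_subset_topspace)
  then have f: "continuous_map (subtopology X V) euclideanreal f" "\<forall>x\<in>V. f x \<noteq> 0"
    using assms(2) by (auto simp: carrier_units_sheaf_iff)
  have "connected (f ` V)"
    using connectedin_continuous_map_image[OF f(1), of V] assms(1)
    by (simp add: connectedin_subtopology)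
  have no_crossing: False if uv: "u \<in> V" "v \<in> V" "f u < 0" "\<not> f v < 0" for u v
  proof -
    have "0 \<in> f ` V"
      using connectedD_interval[OF \<open>connected (f ` V)\<close>, of "f u" "f v" 0] uv by simp
    then show False using f(2) by auto
  qed
  show ?thesis using no_crossing[OF assms(3,4)] no_crossing[OF assms(4,3)] by argo
qed

section \<open>Signs as Cech cochains\<close>

context subset_family
begin

lemma sign_cochain_closed: "sign_cochain I U \<tau> \<in> carrier (units_C X I U (Suc 0))"
  unfolding units_C_carrier_iff
  by (auto simp: sign_cochain_def intro!: units_sheaf_const_closed overlap_subset)

lemma sign_cochain_hom: "sign_cochain I U \<in> hom (nerve_C I U (Suc 0)) (units_C X I U (Suc 0))"
proof (rule homI)
  fix \<tau> \<tau>'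
  show "sign_cochain I U (\<tau> \<otimes>\<^bsub>nerve_C I U (Suc 0)\<^esub> \<tau>')
      = sign_cochain I U \<tau> \<otimes>\<^bsub>units_C X I U (Suc 0)\<^esub> sign_cochain I U \<tau>'"
  proof (rule extensionalityI)
    fix js assume "js \<in> tuples I (Suc 0)"
    then obtain a b where js: "a \<in> I" "b \<in> I" "js = [a, b]" by (auto simp: tuples_1_iff)
    \<comment> \<open>The formula is only claimed in the presence of a point \<open>x\<close>: over
      an empty overlap both sections are the empty function.\<close>
    have "edge_value (\<tau> \<otimes>\<^bsub>nerve_C I U (Suc 0)\<^esub> \<tau>') a b = (edge_value \<tau> a b + edge_value \<tau>' a b) mod 2"
      if "x \<in> U a" "x \<in> U b" for x
      using edge_value_mult[OF js(1,2), of U \<tau> \<tau>'] that by blast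
    with js show "sign_cochain I U (\<tau> \<otimes>\<^bsub>nerve_C I U (Suc 0)\<^esub> \<tau>') js
        = (sign_cochain I U \<tau> \<otimes>\<^bsub>units_C X I U (Suc 0)\<^esub> sign_cochain I U \<tau>') js"
      by (auto simp: sign_cochain_apply units_C_mult tuples_1_iff overlap_def
          power_int_minus_one fun_eq_iff restrict_def)
  qed (auto simp: sign_cochain_def units_C_mult)
qed (rule sign_cochain_closed)

lemma sign_cochain_cocycle:
  assumes "\<tau> \<in> cocycles (nerve_C I U) (nerve_d I U) (Suc 0)"
  shows "sign_cochain I U \<tau> \<in> cocycles (units_C X I U) (units_d X I U) (Suc 0)"
  unfolding units_cocycles_iff
proof (intro conjI ballI sign_cochain_closed)
  fix a b c x assume abc: "a \<in> I" "b \<in> I" "c \<in> I" and x: "x \<in> U a \<inter> U b \<inter> U c"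
  then have "even (edge_value \<tau> b c + edge_value \<tau> a c + edge_value \<tau> a b)"
    using assms unfolding nerve_cocycles_iff by blast
  then show "sign_cochain I U \<tau> [b, c] x * sign_cochain I U \<tau> [a, b] x = sign_cochain I U \<tau> [a, c] x"
    using abc x by (auto simp: sign_cochain_apply power_int_minus_one)
qed

text \<open>The bounding Cech cochain consists of the constants \<open>(-1) powi c a\<close>. The
  quotient of two of them has exponent \<open>c b - c a\<close>, of the same parity as
  \<open>c a + c b\<close>.\<close>

lemma sign_cochain_coboundary:
  assumes "\<tau> \<in> coboundaries (nerve_C I U) (nerve_d I U) (Suc 0)"
  shows "sign_cochain I U \<tau> \<in> coboundaries (units_C X I U) (units_d X I U) (Suc 0)"
proof -
  obtain c where c: "\<And>a b. a \<in> I \<Longrightarrow> b \<in> I \<Longrightarrow> U a \<inter> U b \<noteq> {} \<Longrightarrow> even (edge_value \<tau> a b + c a + c b)"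
    using assms unfolding nerve_coboundaries_iff by blast
  define f :: "'i list \<Rightarrow> 'a \<Rightarrow> real"
    where "f = (\<lambda>js\<in>tuples I 0. \<lambda>x\<in>overlap U js. (-1) powi c (hd js))"
  have f: "f \<in> carrier (units_C X I U 0)"
    unfolding units_C_carrier_iff
    by (auto simp: f_def intro!: units_sheaf_const_closed overlap_subset)
  have fa: "f [a] = (\<lambda>x\<in>U a. (-1) powi c a)" if "a \<in> I" for a
    using that by (simp add: f_def tuples_0_iff overlap_def)
  have "sign_cochain I U \<tau> = units_d X I U 0 f"
  proof (rule extensionalityI)
    fix js assume "js \<in> tuples I (Suc 0)"
    then obtain a b where js: "a \<in> I" "b \<in> I" "js = [a, b]" by (auto simp: tuples_1_iff)
    have "even (edge_value \<tau> a b + c a + c b)" if "x \<in> U a" "x \<in> U b" for x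
      using c[OF js(1,2)] that by blast
    with js show "sign_cochain I U \<tau> js = units_d X I U 0 f js"
      using f
      by (auto simp: sign_cochain_apply units_d_0 fa power_int_minus_one fun_eq_iff restrict_def)
  qed (auto simp: sign_cochain_def cech_coboundary_def)
  then show ?thesis using f by (auto simp: coboundaries_def)
qed

lemma cochain_map_sign_cochain:
  "cochain_map (nerve_C I U) (nerve_d I U) (units_C X I U) (units_d X I U) 0 (sign_cochain I U)"
proof (rule cochain_map.intro[OF cochain_segment_nerve cochain_segment_units], rule cochain_map_axioms.intro)
qed (fact sign_cochain_hom, erule sign_cochain_cocycle, erule sign_cochain_coboundary)

lemma sign_cochain_coboundary_reflect:
  assumes conn: "\<And>r. r \<in> I \<Longrightarrow> connectedin X (U r)"
    and \<tau>: "\<tau> \<in> carrier (nerve_C I U (Suc 0))"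
    and cob: "sign_cochain I U \<tau> \<in> coboundaries (units_C X I U) (units_d X I U) (Suc 0)"
  shows "\<tau> \<in> coboundaries (nerve_C I U) (nerve_d I U) (Suc 0)"
proof -
  obtain f where f: "f \<in> carrier (units_C X I U 0)" and eq: "sign_cochain I U \<tau> = units_d X I U 0 f"
    using cob by (auto simp: coboundaries_def)
  \<comment> \<open>The bit records whether \<open>f [a]\<close> is negative somewhere; by
    connectedness it is then negative everywhere on \<open>U a\<close>. An empty \<open>U a\<close>
    receives 0, but meets no other set.\<close>
  define c :: "'i \<Rightarrow> int" where "c a = (if \<exists>x\<in>U a. f [a] x < 0 then 1 else 0)" for a
  have sign: "f [a] x \<noteq> 0" "f [a] x < 0 \<longleftrightarrow> odd (c a)" if "a \<in> I" "x \<in> U a" for a x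
  proof -
    have "[a] \<in> tuples I 0" and ov: "overlap U [a] = U a"
      using that by (simp_all add: tuples_0_iff overlap_def)
    then have fa: "f [a] \<in> carrier (sections (units_sheaf X) (U a))"
      using f unfolding units_C_carrier_iff ov[symmetric] by blast
    then show "f [a] x \<noteq> 0"
      using that(2) carrier_units_sheaf_iff[OF family_subset[OF that(1)]] by blast
    have "f [a] y < 0 \<longleftrightarrow> f [a] x < 0" if "y \<in> U a" for y
      using connected_nonzero_sign[OF conn[OF \<open>a \<in> I\<close>] fa that \<open>x \<in> U a\<close>] .
    moreover have "odd (c a) \<longleftrightarrow> (\<exists>y\<in>U a. f [a] y < 0)"
      by (simp add: c_def)
    ultimately show "f [a] x < 0 \<longleftrightarrow> odd (c a)"
      using \<open>x \<in> U a\<close> by blast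
  qed
  have "even (edge_value \<tau> a b + c a + c b)" if ab: "a \<in> I" "b \<in> I" "U a \<inter> U b \<noteq> {}" for a b
  proof -
    obtain x where x: "x \<in> U a" "x \<in> U b" using ab by auto
    \<comment> \<open>The quotient is negative exactly when one of the two values is, and by
      hypothesis it is also the sign attached to the edge. A single point of the overlap suffices
      for this comparison.\<close>
    define q where "q = f [b] x * inverse (f [a] x)"
    have "q < 0 \<longleftrightarrow> odd (c a + c b)"
      using sign[OF ab(1) x(1)] sign[OF ab(2) x(2)]
      unfolding q_def mult_less_0_iff by (simp add: linorder_neq_iff) argo
    moreover have "sign_cochain I U \<tau> [a, b] x = q"
      unfolding eq units_d_0[OF f ab(1,2)] q_def using x by simp
    then have "(-1) powi edge_value \<tau> a b = q"
      unfolding sign_cochain_apply[OF ab(1,2)] using x by simp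
    then have "q < 0 \<longleftrightarrow> odd (edge_value \<tau> a b)"
      unfolding power_int_minus_one by (cases "even (edge_value \<tau> a b)") auto
    ultimately show ?thesis unfolding even_add by argo
  qed
  then show ?thesis using \<tau> unfolding nerve_coboundaries_iff by blast
qed

end

text \<open>The naturality square commutes before passing to classes: a collapsed edge gives the
  constant 1 on both sides, and an empty overlap gives the empty function.\<close>

lemma (in refined_family) sign_cochain_pullback:
  "sign_cochain J V (simplicial_pullback (nerve J V) p (Suc 0) \<tau>)
     = cech_pullback (units_sheaf X) U J V p (Suc 0) (sign_cochain I U \<tau>)"
proof (rule extensionalityI)
  fix js assume "js \<in> tuples J (Suc 0)"
  then obtain s t where js: "s \<in> J" "t \<in> J" "js = [s, t]" by (auto simp: tuples_1_iff)
  moreover have "p s \<in> I" "p t \<in> I" "V s \<subseteq> U (p s)" "V t \<subseteq> U (p t)"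
    using refining js by (auto simp: refining_map_def)
  moreover have "edge_value (simplicial_pullback (nerve J V) p (Suc 0) \<tau>) s t = edge_value \<tau> (p s) (p t)"
    if "x \<in> V s" "x \<in> V t" for x
    using edge_value_pullback[OF js(1,2), of V p \<tau>] that by blast
  ultimately show "sign_cochain J V (simplicial_pullback (nerve J V) p (Suc 0) \<tau>) js
      = cech_pullback (units_sheaf X) U J V p (Suc 0) (sign_cochain I U \<tau>) js"
    by (auto simp: sign_cochain_apply cech_pullback_apply tuples_1_iff overlap_def fun_eq_iff
        restrict_def)
qed (auto simp: sign_cochain_def cech_pullback_def)

lemma open_cover_subset_family: "open_cover X I U \<Longrightarrow> subset_family X I U"
  by (auto simp: open_cover_def subset_family_def)

text \<open>All four sides of the square are induced by cochain maps, so on a class with chosen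
  cocycle \<open>\<tau>\<close> both composites are classes of explicit cochains, and these are
  equal by \<open>sign_cochain_pullback\<close>.\<close>

lemma Phi_natural:
  assumes "subset_family B I U" "subset_family B J V" "refining_map J V I U p"
    and "\<xi> \<in> carrier (nerve_H1 I U)"
  shows "Phi B J V (nerve_refine J V p \<xi>) = units_refine B U J V p (Phi B I U \<xi>)"
proof -
  interpret refined_family B I U J V p
    using assms by (simp add: refined_family_def refined_family_axioms_def)
  interpret N: cochain_map "nerve_C I U" "nerve_d I U" "nerve_C J V" "nerve_d J V" 0
    "simplicial_pullback (nerve J V) p (Suc 0)"
    by (rule cochain_map_simplicial_pullback[OF refining])
  interpret C: cochain_map "units_C B I U" "units_d B I U" "units_C B J V" "units_d B J V" 0
    "cech_pullback (units_sheaf B) U J V p (Suc 0)"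
    by (rule cochain_map_cech_pullback)
  interpret SI: cochain_map "nerve_C I U" "nerve_d I U" "units_C B I U" "units_d B I U" 0
    "sign_cochain I U"
    by (rule coarse.cochain_map_sign_cochain)
  interpret SJ: cochain_map "nerve_C J V" "nerve_d J V" "units_C B J V" "units_d B J V" 0
    "sign_cochain J V"
    by (rule fine.cochain_map_sign_cochain)
  obtain \<tau> where "\<tau> \<in> cocycles (nerve_C I U) (nerve_d I U) (Suc 0)"
    "\<xi> = cohomology_class (nerve_C I U) (nerve_d I U) (Suc 0) \<tau>"
    using assms(4) by (auto simp: N.source.carrier_cohomology)
  then show ?thesis
    by (simp add: Phi_def nerve_refine_def units_refine_def N.induced_map_class C.induced_map_class
        SI.induced_map_class SJ.induced_map_class N.map_cocycles SI.map_cocycles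
        sign_cochain_pullback)
qed

theorem proposition4p3:
  fixes B :: "'a topology" and I :: "'i set" and U :: "'i \<Rightarrow> 'a set"
  assumes "paracompact_space B" and "Hausdorff_space B" and "open_cover B I U"
  shows
    "(\<forall>\<tau>\<in>cocycles (nerve_C I U) (nerve_d I U) 1.
        sign_cochain I U \<tau> \<in> cocycles (units_C B I U) (units_d B I U) 1 \<and>
        Phi B I U (cohomology_class (nerve_C I U) (nerve_d I U) 1 \<tau>)
          = cohomology_class (units_C B I U) (units_d B I U) 1 (sign_cochain I U \<tau>)) \<and>
     group_hom (nerve_H1 I U) (units_H1 B I U) (Phi B I U) \<and>
     (\<forall>(J :: 'j set) V p. open_cover B J V \<and> refining_map J V I U p \<longrightarrow>
        group_hom (nerve_H1 I U) (nerve_H1 J V) (nerve_refine J V p) \<and>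
        group_hom (units_H1 B I U) (units_H1 B J V) (units_refine B U J V p) \<and>
        (\<forall>\<xi>\<in>carrier (nerve_H1 I U).
           Phi B J V (nerve_refine J V p \<xi>) = units_refine B U J V p (Phi B I U \<xi>))) \<and>
     ((\<forall>r\<in>I. connectedin B (U r)) \<longrightarrow>
        inj_on (Phi B I U) (carrier (nerve_H1 I U)))"
proof -
  interpret subset_family B I U
    using assms(3) by (rule open_cover_subset_family)
  \<comment> \<open>The locale treats degree \<open>Suc n\<close>; the instance \<open>n = 0\<close>
    is the degree 1 of the statement.\<close>
  interpret S: cochain_map "nerve_C I U" "nerve_d I U" "units_C B I U" "units_d B I U" 0
    "sign_cochain I U"
    by (rule cochain_map_sign_cochain)
  have "group_hom (nerve_H1 I U) (nerve_H1 J V) (nerve_refine J V p) \<and>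
      group_hom (units_H1 B I U) (units_H1 B J V) (units_refine B U J V p) \<and>
      (\<forall>\<xi>\<in>carrier (nerve_H1 I U).
         Phi B J V (nerve_refine J V p \<xi>) = units_refine B U J V p (Phi B I U \<xi>))"
    if "open_cover B J V" and p: "refining_map J V I U p" for J :: "'j set" and V p
  proof -
    have fine: "subset_family B J V" using that(1) by (rule open_cover_subset_family)
    then have rf: "refined_family B I U J V p"
      using p by (simp add: refined_family_def refined_family_axioms_def subset_family_axioms)
    show ?thesis
      using cochain_map.group_hom_induced_map[OF cochain_map_simplicial_pullback[OF p]]
        cochain_map.group_hom_induced_map[OF refined_family.cochain_map_cech_pullback[OF rf]]
        Phi_natural[OF subset_family_axioms fine p]
      by (simp add: nerve_refine_def units_refine_def)
  qed
  moreover have "inj_on (Phi B I U) (carrier (nerve_H1 I U))" if "\<forall>r\<in>I. connectedin B (U r)"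
    using S.inj_on_induced_map sign_cochain_coboundary_reflect that S.source.cocycles_closed
    by (simp add: Phi_def)
  ultimately show ?thesis
    using S.group_hom_induced_map S.induced_map_class S.map_cocycles
    by (simp add: Phi_def)
qed

end
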